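(* Let $X$ be a complete doubling metric space, let $\{E_{\mathtt{i}}\}_{\mathtt{i}\in\Sigma}$ be a Moran construction in $X$ with limit set $E$, and let $\mu$ be a measure on $E$. Suppose that \[ \liminf_{n\to\infty}-\tfrac1n\log\operatorname{diam}(E_{\mathtt{i}|_n})>0\quad\text{for each }\mathtt{i}\in\Sigma_\infty, \] and \[ \sum_{n=1}^\infty n^{-2}\sup_{\mathtt{i}\in\Sigma_n}\sum_{\mathtt{j}\prec\mathtt{i}}p_{\mathtt{j}}\bigl((\log p_{\mathtt{j}})^2+(\log c_{\mathtt{j}})^2\bigr)<\infty. \] Then for $\mu$-almost all $x_{\mathtt{i}}\in E$, \[ \overline{\dim}_{\mathrm{loc}}(\mu,x_{\mathtt{i}})=\limsup_{N\to\infty}\frac{\sum_{n=1}^N\sum_{\mathtt{j}\prec\mathtt{i}|_n}p_{\mathtt{j}}\log p_{\mathtt{j}}}{\sum_{n=1}^N\sum_{\mathtt{j}\prec\mathtt{i}|_n}p_{\mathtt{j}}\log c_{\mathtt{j}}},\qquad \underline{\dim}_{\mathrm{loc}}(\mu,x_{\mathtt{i}})=\liminf_{N\to\infty}\frac{\sum_{n=1}^N\sum_{\mathtt{j}\prec\mathtt{i}|_n}p_{\mathtt{j}}\log p_{\mathtt{j}}}{\sum_{n=1}^N\sum_{\mathtt{j}\prec\mathtt{i}|_n}p_{\mathtt{j}}\log c_{\mathtt{j}}}. \]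
   Context: A metric space is doubling if there is $N$ such that every closed ball $B(x,r)$ is covered by $N$ closed balls of radius $r/2$. A "measure" is a nontrivial Borel regular outer measure, finite on bounded sets. Local dimensions: $\overline{\dim}_{\mathrm{loc}}(\mu,x)=\limsup_{r\downarrow0}\log\mu(B(x,r))/\log r$, $\underline{\dim}_{\mathrm{loc}}(\mu,x)=\liminf_{r\downarrow0}\log\mu(B(x,r))/\log r$. Words: $I$ countable, $I^0=\{\varnothing\}$, $I^\infty=I^{\mathbb{N}}$; $\mathtt{i}|_n=i_1\cdots i_n$, $\mathtt{i}|_0=\varnothing$, $\mathtt{i}^-=\mathtt{i}|_{n-1}$ for $\mathtt{i}\in I^n$. For $\Sigma\subset\bigcup_{n\ge0}I^n$, $\Sigma_n=\Sigma\cap I^n$, $\Sigma_\infty=\{\mathtt{i}\in I^\infty:\mathtt{i}|_n\in\Sigma_n\ \forall n\}$; $\mathtt{j}\prec\mathtt{i}$ means $\mathtt{j}=\mathtt{i}i\in\Sigma$ for some $i\in I$. $\Sigma$ is a codetree if $\varnothing\in\Sigma$, $\mathtt{i}^-\in\Sigma$ whenever $\varnothing\neq\mathtt{i}\in\Sigma$, and every $\mathtt{i}\in\Sigma$ has a positive finite number of offspring. A Moran construction is a collection $\{E_{\mathtt{i}}\subset X:\mathtt{i}\in\Sigma\}$ of compact sets of positive diameter, $\Sigma$ a codetree, with: (M1) $E_{\mathtt{i}}\subset E_{\mathtt{i}^-}$; (M2) $\operatorname{diam}(E_{\mathtt{i}|_n})\to0$ for each $\mathtt{i}\in\Sigma_\infty$;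 (M3) $E_{\mathtt{i}i}\cap E_{\mathtt{i}j}=\emptyset$ for $i\ne j$; (M4) a uniform $C_0>0$ such that each $E_{\mathtt{i}}$ contains $B(x,C_0\operatorname{diam}(E_{\mathtt{i}}))$ for some $x\in E_{\mathtt{i}}$; (M5) $\log\operatorname{diam}(E_{\mathtt{i}|_n})/\log\min\{\operatorname{diam}(E_{\mathtt{j}}):\mathtt{j}\prec\mathtt{i}|_n\}\to1$ uniformly in $\mathtt{i}\in\Sigma_\infty$. Limit set $E=\bigcap_n\bigcup_{\mathtt{i}\in\Sigma_n}E_{\mathtt{i}}$; $x_{\mathtt{i}}$ is the point of $\bigcap_nE_{\mathtt{i}|_n}$ for $\mathtt{i}\in\Sigma_\infty$. For $\varnothing\ne\mathtt{i}\in\Sigma$: $p_{\mathtt{i}}=\mu(E_{\mathtt{i}})/\mu(E_{\mathtt{i}^-})$, $c_{\mathtt{i}}=\operatorname{diam}(E_{\mathtt{i}})/\operatorname{diam}(E_{\mathtt{i}^-})$; $p_\varnothing=\mu(E_\varnothing)$, $c_\varnothing=\operatorname{diam}(E_\varnothing)$; if $\mu(E_{\mathtt{i}})=0$ then $p_{\mathtt{j}}=0$ for all $\mathtt{j}\prec\mathtt{i}$. The convention $0\log0=0$ (and $0\cdot(\log 0)^2=0$) is used. *)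

theory Defs
  imports "HOL-Analysis.Analysis" "HOL-Probability.Probability"
begin

definition doubling :: "'a::metric_space set \<Rightarrow> bool" where
  "doubling X \<longleftrightarrow> (\<exists>N::nat. \<forall>x\<in>X. \<forall>r>0. \<exists>C. C \<subseteq> X \<and> finite C \<and> card C \<le> N \<and>
       cball x r \<inter> X \<subseteq> (\<Union>c\<in>C. cball c (r/2)))"

text \<open>Finite words are lists [i_1,...,i_n]; the parent of a word is its butlast.
  Infinite words are functions nat => 'i, with i_1 = w 0.\<close>
definition pfx :: "(nat \<Rightarrow> 'i) \<Rightarrow> nat \<Rightarrow> 'i list" where
  "pfx w n = map w [0..<n]"

definition level :: "'i list set \<Rightarrow> nat \<Rightarrow> 'i list set" where
  "level \<Sigma> n = {v \<in> \<Sigma>. length v = n}"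

definition infwords :: "'i list set \<Rightarrow> (nat \<Rightarrow> 'i) set" where
  "infwords \<Sigma> = {w. \<forall>n. pfx w n \<in> \<Sigma>}"

definition children :: "'i list set \<Rightarrow> 'i list \<Rightarrow> 'i list set" where
  "children \<Sigma> v = {u \<in> \<Sigma>. \<exists>i. u = v @ [i]}"

definition codetree :: "'i list set \<Rightarrow> bool" where
  "codetree \<Sigma> \<longleftrightarrow> [] \<in> \<Sigma> \<and> (\<forall>v\<in>\<Sigma>. v \<noteq> [] \<longrightarrow> butlast v \<in> \<Sigma>)
     \<and> (\<forall>v\<in>\<Sigma>. finite (children \<Sigma> v) \<and> children \<Sigma> v \<noteq> {})"

definition moran :: "'i list set \<Rightarrow> ('i list \<Rightarrow> 'a::metric_space set) \<Rightarrow> bool" where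
  "moran \<Sigma> E \<longleftrightarrow> codetree \<Sigma>
     \<and> (\<forall>v\<in>\<Sigma>. compact (E v) \<and> diameter (E v) > 0)
     \<and> (\<forall>v\<in>\<Sigma>. v \<noteq> [] \<longrightarrow> E v \<subseteq> E (butlast v))
     \<and> (\<forall>w\<in>infwords \<Sigma>. (\<lambda>n. diameter (E (pfx w n))) \<longlonglongrightarrow> 0)
     \<and> (\<forall>v i j. v @ [i] \<in> \<Sigma> \<longrightarrow> v @ [j] \<in> \<Sigma> \<longrightarrow> i \<noteq> j \<longrightarrow> E (v @ [i]) \<inter> E (v @ [j]) = {})
     \<and> (\<exists>C0>0. \<forall>v\<in>\<Sigma>. \<exists>x\<in>E v. cball x (C0 * diameter (E v)) \<subseteq> E v)
     \<and> (\<forall>\<epsilon>>0. \<exists>N. \<forall>n\<ge>N. \<forall>w\<in>infwords \<Sigma>.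
          \<bar>ln (diameter (E (pfx w n))) / ln (Min (diameter ` E ` children \<Sigma> (pfx w n))) - 1\<bar> < \<epsilon>)"

definition limit_set :: "'i list set \<Rightarrow> ('i list \<Rightarrow> 'a set) \<Rightarrow> 'a set" where
  "limit_set \<Sigma> E = (\<Inter>n. \<Union>v\<in>level \<Sigma> n. E v)"

text \<open>The (unique) point x_w lies in this set.\<close>
definition coding_set :: "('i list \<Rightarrow> 'a set) \<Rightarrow> (nat \<Rightarrow> 'i) \<Rightarrow> 'a set" where
  "coding_set E w = (\<Inter>n. E (pfx w n))"

text \<open>Real division by 0 gives 0 in Isabelle, which realises the convention
  p_j = 0 for children j of a word i with mu(E_i) = 0.\<close>
definition pw :: "'a measure \<Rightarrow> ('i list \<Rightarrow> 'a set) \<Rightarrow> 'i list \<Rightarrow> real" where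
  "pw M E v = (if v = [] then measure M (E []) else measure M (E v) / measure M (E (butlast v)))"

definition cw :: "('i list \<Rightarrow> 'a::metric_space set) \<Rightarrow> 'i list \<Rightarrow> real" where
  "cw E v = (if v = [] then diameter (E []) else diameter (E v) / diameter (E (butlast v)))"

definition plogp :: "real \<Rightarrow> real" where
  "plogp p = (if p = 0 then 0 else p * ln p)"

definition psq :: "real \<Rightarrow> real \<Rightarrow> real" where
  "psq p c = (if p = 0 then 0 else p * ((ln p)^2 + (ln c)^2))"

text \<open>log mu(B(x,r)) / log r as an extended real; log 0 = -infinity, so for 0 < r < 1
  the quotient is +infinity when mu(B(x,r)) = 0.\<close>
definition logratio :: "'a::metric_space measure \<Rightarrow> 'a \<Rightarrow> real \<Rightarrow> ereal" where
  "logratio M x r = (if measure M (cball x r) = 0 then (if r < 1 then \<infinity> else -\<infinity>)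
      else ereal (ln (measure M (cball x r)) / ln r))"

definition upper_local_dim :: "'a::metric_space measure \<Rightarrow> 'a \<Rightarrow> ereal" where
  "upper_local_dim M x = Limsup (at_right 0) (logratio M x)"

definition lower_local_dim :: "'a::metric_space measure \<Rightarrow> 'a \<Rightarrow> ereal" where
  "lower_local_dim M x = Liminf (at_right 0) (logratio M x)"

definition entropy_ratio :: "'a measure \<Rightarrow> 'i list set \<Rightarrow> ('i list \<Rightarrow> 'a::metric_space set)
    \<Rightarrow> (nat \<Rightarrow> 'i) \<Rightarrow> nat \<Rightarrow> real" where
  "entropy_ratio M \<Sigma> E w N =
     (\<Sum>n=1..N. \<Sum>j\<in>children \<Sigma> (pfx w n). plogp (pw M E j)) /
     (\<Sum>n=1..N. \<Sum>j\<in>children \<Sigma> (pfx w n). pw M E j * ln (cw E j))"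

end

(* Two comparisons give the theorem.

   Cylinders versus balls.  At scale r = 2^-k consider the cylinders whose diameter is the first
   along their branch to drop below r.  By (M5) their diameters are at least r^(1+eta), by (M4)
   they contain balls of comparable size, and they are disjoint, so doubling lets only r^(-delta)
   of them meet a ball of radius r.  Hence the cylinders having a point x with
   mu(B(x,r)) > r^(-2 delta) mu(cylinder) have total mass O(r^delta), and Borel-Cantelli reduces
   the local dimensions to the limits of log mu / log diam along cylinders.

   Cylinders versus entropies.  The logarithms of the mass and of the diameter of a cylinder are
   sums of log p and log c along the branch.  Subtracting the conditional means leaves sums of
   martingale differences, which are o(N) almost everywhere by a Hajek-Renyi inequality on the
   tree; since -log diam grows at least linearly, this error does not affect the quotients. *)
theory Submission
  imports Defs "HOL-Library.Sublist"
begin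

section \<open>Upper and lower limits of quotients\<close>

text \<open>(M5) relates consecutive diameters only on the logarithmic scale, and \<open>M\<close>
  itself is not assumed doubling. A ball of radius 2^-k may thus meet more and more cylinders of its
  scale as k grows, and may be much heavier than the cylinder holding its centre. What makes the
  comparison possible is that a factor exp(o(k)) is invisible after division by k ln 2, so it
  suffices to bound the total mass of the cylinders where the loss is exponential. Borel-Cantelli
  treats countably many radii; monotonicity of the ball mass in the radius fills the gaps between
  them, and (M5) along one branch fills the gaps between generations. On the tree, conditional
  expectation given a cylinder is the finite sum over its children weighted by \<open>pw\<close>.
  The supremum over \<open>level\<close> in the summability hypothesis turns conditional variances
  into plain numbers, so the martingale argument runs on functions of words, without filtrations or
  random variables.\<close>

text \<open>Only a fixed real c, chosen strictly between a limit and a competitor, is ever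
  multiplied by \<tau>, and c * \<tau> + \<sigma> tends to c. Hence u may be unbounded and the
  limits may be infinite.\<close>

lemma Limsup_Liminf_le_asymp:
  fixes u v \<tau> \<sigma> :: "'b \<Rightarrow> real"
  assumes le: "eventually (\<lambda>x. v x \<le> u x * \<tau> x + \<sigma> x) F"
    and \<tau>: "(\<tau> \<longlongrightarrow> 1) F" and \<sigma>: "(\<sigma> \<longlongrightarrow> 0) F"
  shows "Limsup F (\<lambda>x. ereal (v x)) \<le> Limsup F (\<lambda>x. ereal (u x))"
    and "Liminf F (\<lambda>x. ereal (v x)) \<le> Liminf F (\<lambda>x. ereal (u x))"
proof -
  have \<tau>pos: "eventually (\<lambda>x. \<tau> x > 0) F"
    using order_tendstoD(1)[OF \<tau>, of 0] by simp
  show "Limsup F (\<lambda>x. ereal (v x)) \<le> Limsup F (\<lambda>x. ereal (u x))"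
    unfolding Limsup_le_iff
  proof (intro allI impI)
    fix y assume y: "Limsup F (\<lambda>x. ereal (u x)) < y"
    then obtain c where c: "Limsup F (\<lambda>x. ereal (u x)) < ereal c" "ereal c < y"
      using ereal_dense2 by blast
    then obtain c' where c': "ereal c < ereal c'" "ereal c' < y"
      using ereal_dense2 by blast
    have "eventually (\<lambda>x. ereal (u x) < ereal c) F"
      using Limsup_le_iff[of F "\<lambda>x. ereal (u x)" "Limsup F (\<lambda>x. ereal (u x))"] c(1) by blast
    moreover have "((\<lambda>x. c * \<tau> x + \<sigma> x) \<longlongrightarrow> c * 1 + 0) F"
      by (intro tendsto_intros \<tau> \<sigma>)
    then have "eventually (\<lambda>x. c * \<tau> x + \<sigma> x < c') F"
      using order_tendstoD(2) c'(1) by fastforce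
    ultimately show "eventually (\<lambda>x. ereal (v x) < y) F"
      using le \<tau>pos
    proof eventually_elim
      case (elim x)
      have "u x * \<tau> x \<le> c * \<tau> x" using elim by (intro mult_right_mono) auto
      then have "v x < c'" using elim by linarith
      then have "ereal (v x) < ereal c'" by simp
      then show ?case using c'(2) by (rule less_trans)
    qed
  qed
  show "Liminf F (\<lambda>x. ereal (v x)) \<le> Liminf F (\<lambda>x. ereal (u x))"
    unfolding le_Liminf_iff
  proof (intro allI impI)
    fix y assume y: "y < Liminf F (\<lambda>x. ereal (v x))"
    then obtain c' where c': "ereal c' < Liminf F (\<lambda>x. ereal (v x))" "y < ereal c'"
      using ereal_dense2 by blast
    then obtain c where c: "ereal c < ereal c'" "y < ereal c"
      using ereal_dense2 by blast
    have "eventually (\<lambda>x. ereal c' < ereal (v x)) F"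
      using le_Liminf_iff[of "Liminf F (\<lambda>x. ereal (v x))" F "\<lambda>x. ereal (v x)"] c'(1) by blast
    moreover have "((\<lambda>x. c * \<tau> x + \<sigma> x) \<longlongrightarrow> c * 1 + 0) F"
      by (intro tendsto_intros \<tau> \<sigma>)
    then have "eventually (\<lambda>x. c * \<tau> x + \<sigma> x < c') F"
      using order_tendstoD(2) c(1) by fastforce
    ultimately show "eventually (\<lambda>x. y < ereal (u x)) F"
      using le \<tau>pos
    proof eventually_elim
      case (elim x)
      have "c' < v x" using elim by simp
      then have "c * \<tau> x < u x * \<tau> x" using elim by linarith
      then have "ereal c < ereal (u x)" using elim by simp
      then show ?case using c(2) less_trans by blast
    qed
  qed
qed

text \<open>Solving the inequality for u gives the previous situation with factor 1 / \<tau> and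
  error - \<sigma> / \<tau>.\<close>

lemma Limsup_Liminf_ge_asymp:
  fixes u v \<tau> \<sigma> :: "'b \<Rightarrow> real"
  assumes le: "eventually (\<lambda>x. u x * \<tau> x + \<sigma> x \<le> v x) F"
    and \<tau>: "(\<tau> \<longlongrightarrow> 1) F" and \<sigma>: "(\<sigma> \<longlongrightarrow> 0) F"
  shows "Limsup F (\<lambda>x. ereal (u x)) \<le> Limsup F (\<lambda>x. ereal (v x))"
    and "Liminf F (\<lambda>x. ereal (u x)) \<le> Liminf F (\<lambda>x. ereal (v x))"
proof -
  have "eventually (\<lambda>x. \<tau> x > 0) F"
    using order_tendstoD(1)[OF \<tau>, of 0] by simp
  with le have le': "eventually (\<lambda>x. u x \<le> v x * (1 / \<tau> x) + - \<sigma> x / \<tau> x) F"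
    by eventually_elim (simp add: field_simps)
  have 1: "((\<lambda>x. 1 / \<tau> x) \<longlongrightarrow> 1) F" "((\<lambda>x. - \<sigma> x / \<tau> x) \<longlongrightarrow> 0) F"
    using tendsto_divide[OF tendsto_const[of 1] \<tau>] tendsto_divide[OF tendsto_minus[OF \<sigma>] \<tau>] by auto
  show "Limsup F (\<lambda>x. ereal (u x)) \<le> Limsup F (\<lambda>x. ereal (v x))"
    "Liminf F (\<lambda>x. ereal (u x)) \<le> Liminf F (\<lambda>x. ereal (v x))"
    using Limsup_Liminf_le_asymp[OF le' 1] by auto
qed

lemma Limsup_comp_le:
  fixes f :: "'b \<Rightarrow> 'c :: complete_lattice"
  assumes "filterlim g G F"
  shows "Limsup F (\<lambda>x. f (g x)) \<le> Limsup G f"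
proof -
  have "Limsup F (\<lambda>x. f (g x)) \<le> Limsup (filtermap g F) f" by (rule Limsup_filtermap_ge)
  also have "\<dots> \<le> Limsup G f"
    using assms unfolding Limsup_def filterlim_def by (intro INF_superset_mono) (auto dest: filter_leD)
  finally show ?thesis .
qed

lemma Liminf_comp_ge:
  fixes f :: "'b \<Rightarrow> 'c :: complete_lattice"
  assumes "filterlim g G F"
  shows "Liminf G f \<le> Liminf F (\<lambda>x. f (g x))"
proof -
  have "Liminf G f \<le> Liminf (filtermap g F) f"
    using assms unfolding Liminf_def filterlim_def by (intro SUP_subset_mono) (auto dest: filter_leD)
  also have "\<dots> \<le> Liminf F (\<lambda>x. f (g x))" by (rule Liminf_filtermap_le)
  finally show ?thesis .
qed

text \<open>The substitution r = exp(-t) turns the local dimensions into limits of G(t) / t at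
  infinity, where G(t) is minus the logarithm of the ball mass and is monotone.\<close>

lemma at_right_0_eq_exp_uminus: "at_right (0::real) = filtermap (\<lambda>t. exp (- t)) at_top"
proof -
  have "filtermap exp at_bot = at_right (0::real)"
    by (rule filtermap_fun_inverse[where g = ln, OF ln_at_0])
      (auto simp: filterlim_at exp_at_bot eventually_at_filter)
  then show ?thesis by (simp add: at_bot_mirror filtermap_filtermap)
qed

text \<open>For b = -log diam along a branch, the least n is the first generation of diameter at
  most exp(-t). It passes any m once t exceeds the finitely many values b 0, ..., b m.\<close>

lemma filterlim_Least_at_top:
  fixes b :: "nat \<Rightarrow> real"
  assumes "filterlim b at_top sequentially"
  shows "filterlim (\<lambda>t. LEAST n. t \<le> b n) sequentially at_top"
  unfolding filterlim_at_top
proof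
  fix m :: nat
  have ex: "\<exists>n. t \<le> b n" for t
    using assms unfolding filterlim_at_top eventually_sequentially by blast
  show "eventually (\<lambda>t. m \<le> (LEAST n. t \<le> b n)) at_top"
    unfolding eventually_at_top_linorder
  proof (intro exI allI impI)
    fix t assume t: "t \<ge> Max (b ` {..m}) + 1"
    have "b n < t" if "n \<le> m" for n
    proof -
      have "b n \<le> Max (b ` {..m})" using that by (intro Max_ge) auto
      then show ?thesis using t by linarith
    qed
    moreover have "t \<le> b (LEAST n. t \<le> b n)" using ex by (rule LeastI_ex)
    ultimately show "m \<le> (LEAST n. t \<le> b n)" by (meson linorder_not_le nat_le_linear)
  qed
qed

text \<open>The scales \<open>k ln 2\<close> suffice for the lower bound of \<open>G\<close>, because \<open>G\<close> is monotone and
  consecutive scales have ratio tending to 1.\<close>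
lemma Limsup_Liminf_scale_eq:
  fixes G :: "real \<Rightarrow> real" and a b :: "nat \<Rightarrow> real"
  defines "N \<equiv> \<lambda>t. LEAST n. t \<le> b n"
  assumes G: "mono G" and a: "incseq a"
    and b_mono: "incseq b" and b: "filterlim b at_top sequentially"
    and bratio: "(\<lambda>n. b n / b (Suc n)) \<longlonglongrightarrow> 1"
    and upper: "\<And>n t. t \<le> b n \<Longrightarrow> G t \<le> a n"
    and lower: "(\<lambda>k. (a (N (real k * ln 2)) - G (real k * ln 2)) / real k) \<longlonglongrightarrow> 0"
  shows "Limsup at_top (\<lambda>t. ereal (G t / t)) = limsup (\<lambda>n. ereal (a n / b n))"
    and "Liminf at_top (\<lambda>t. ereal (G t / t)) = liminf (\<lambda>n. ereal (a n / b n))"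
proof -
  have N: "filterlim N sequentially at_top"
    unfolding N_def using b by (rule filterlim_Least_at_top)
  have Nge: "t \<le> b (N t)" for t
  proof -
    have "\<exists>n. t \<le> b n"
      using b unfolding filterlim_at_top eventually_sequentially by blast
    then show ?thesis unfolding N_def by (rule LeastI_ex)
  qed
  have Nless: "b n < t" if "n < N t" for n t
    using not_less_Least[of n "\<lambda>n. t \<le> b n"] that unfolding N_def by simp
  \<comment> \<open>Minimality gives b (N t - 1) < t \<le> b (N t), so the quotient is caught
    between the ratio of consecutive values of b and 1.\<close>
  have tN: "((\<lambda>t. t / b (N t)) \<longlongrightarrow> 1) at_top"
  proof (rule tendsto_sandwich)
    have "filterlim (\<lambda>t. N t - 1) sequentially at_top"
      by (rule filterlim_compose[OF filterlim_minus_const_nat_at_top N])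
    from filterlim_compose[OF bratio this]
    show "((\<lambda>t. b (N t - 1) / b (Suc (N t - 1))) \<longlongrightarrow> 1) at_top" .
    show "((\<lambda>t. 1) \<longlongrightarrow> (1::real)) at_top" by simp
    have "eventually (\<lambda>t. 1 \<le> N t) at_top" using N unfolding filterlim_at_top by blast
    then show "eventually (\<lambda>t. b (N t - 1) / b (Suc (N t - 1)) \<le> t / b (N t)) at_top"
      using eventually_gt_at_top[of 0]
    proof eventually_elim
      case (elim t)
      then have "b (N t) > 0" "b (N t - 1) < t" using Nge[of t] Nless[of "N t - 1" t] by auto
      then show ?case using elim by (simp add: divide_right_mono)
    qed
    show "eventually (\<lambda>t. t / b (N t) \<le> 1) at_top"
      using eventually_gt_at_top[of 0]
    proof eventually_elim
      case (elim t)
      then show ?case using Nge[of t] by simp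
    qed
  qed
  then have bN: "((\<lambda>t. b (N t) / t) \<longlongrightarrow> 1) at_top"
    using tendsto_inverse[OF tN] by (simp add: inverse_eq_divide)
  have bpos: "eventually (\<lambda>n. b n > 0) sequentially"
    using b unfolding filterlim_at_top_dense by blast
  have up: "Limsup at_top (\<lambda>t. ereal (G t / t)) \<le> Limsup at_top (\<lambda>t. ereal (a (N t) / b (N t)))"
  proof (rule Limsup_Liminf_le_asymp(1)[OF _ bN tendsto_const])
    show "eventually (\<lambda>t. G t / t \<le> a (N t) / b (N t) * (b (N t) / t) + 0) at_top"
      using eventually_gt_at_top[of 0]
    proof eventually_elim
      case (elim t)
      have "b (N t) > 0" using Nge[of t] elim by simp
      then show ?case using upper[OF Nge[of t]] elim by (simp add: divide_right_mono)
    qed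
  qed
  also have "\<dots> \<le> limsup (\<lambda>n. ereal (a n / b n))" by (rule Limsup_comp_le[OF N])
  finally have 1: "Limsup at_top (\<lambda>t. ereal (G t / t)) \<le> limsup (\<lambda>n. ereal (a n / b n))" .
  \<comment> \<open>For a lower limit an upper bound along one sequence is enough, and at t = b n
    the hypothesis gives G (b n) \<le> a n.\<close>
  have "Liminf at_top (\<lambda>t. ereal (G t / t)) \<le> liminf (\<lambda>n. ereal (G (b n) / b n))"
    by (rule Liminf_comp_ge[OF b])
  also have "\<dots> \<le> liminf (\<lambda>n. ereal (a n / b n))"
  proof (rule Liminf_mono)
    show "eventually (\<lambda>n. ereal (G (b n) / b n) \<le> ereal (a n / b n)) sequentially"
      using bpos by eventually_elim (auto intro!: divide_right_mono upper)
  qed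
  finally have 2: "Liminf at_top (\<lambda>t. ereal (G t / t)) \<le> liminf (\<lambda>n. ereal (a n / b n))" .

  define \<sigma> where "\<sigma> = (\<lambda>k. (a (N (real k * ln 2)) - G (real k * ln 2)) / real k)"
  have \<sigma>: "\<sigma> \<longlonglongrightarrow> 0" using lower unfolding \<sigma>_def .
  have \<sigma>eq: "G (real k * ln 2) = a (N (real k * ln 2)) - \<sigma> k * real k" if "k > 0" for k
    using that by (simp add: \<sigma>_def)
  \<comment> \<open>Rounding t down to a multiple of ln 2 is right for the lower limit: G at the
    rounded point is at most G t.\<close>
  define \<kappa> where "\<kappa> = (\<lambda>t::real. nat \<lfloor>t / ln 2\<rfloor>)"
  have \<kappa>: "filterlim \<kappa> sequentially at_top" unfolding \<kappa>_def
    by (intro filterlim_compose[OF filterlim_nat_sequentially]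
        filterlim_compose[OF filterlim_floor_sequentially]) real_asymp
  have \<kappa>le: "real (\<kappa> t) * ln 2 \<le> t" and \<kappa>gt: "t < (real (\<kappa> t) + 1) * ln 2" if "t > 0" for t
  proof -
    have "real (\<kappa> t) = of_int \<lfloor>t / ln 2\<rfloor>" using that by (simp add: \<kappa>_def)
    then have "real (\<kappa> t) \<le> t / ln 2" "t / ln 2 < real (\<kappa> t) + 1"
      using floor_correct[of "t / ln 2"] by auto
    then show "real (\<kappa> t) * ln 2 \<le> t" "t < (real (\<kappa> t) + 1) * ln 2"
      by (simp_all add: field_simps)
  qed
  have \<kappa>t: "((\<lambda>t. real (\<kappa> t) * ln 2 / t) \<longlongrightarrow> 1) at_top"
  proof (rule tendsto_sandwich)
    show "((\<lambda>t. 1 - ln 2 / t) \<longlongrightarrow> (1::real)) at_top"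
      by real_asymp
    show "((\<lambda>t. 1) \<longlongrightarrow> (1::real)) at_top" by simp
    show "eventually (\<lambda>t. 1 - ln 2 / t \<le> real (\<kappa> t) * ln 2 / t) at_top"
      using eventually_gt_at_top[of 0]
    proof eventually_elim
      case (elim t)
      have "1 - ln 2 / t = (t - ln 2) / t" using elim by (simp add: field_simps)
      also have "\<dots> \<le> real (\<kappa> t) * ln 2 / t"
        using \<kappa>gt[OF elim] elim by (intro divide_right_mono) (auto simp: distrib_right)
      finally show ?case .
    qed
    show "eventually (\<lambda>t. real (\<kappa> t) * ln 2 / t \<le> 1) at_top"
      using eventually_gt_at_top[of 0]
    proof eventually_elim
      case (elim t)
      then show ?case using \<kappa>le[of t] by simp
    qed
  qed
  have \<kappa>l: "filterlim (\<lambda>t. real (\<kappa> t) * ln 2) at_top at_top"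
    by (rule filterlim_at_top_mult_tendsto_pos[OF tendsto_const])
      (auto intro: filterlim_compose[OF filterlim_real_sequentially \<kappa>])
  have \<kappa>pos: "eventually (\<lambda>t. \<kappa> t \<ge> 1) at_top" using \<kappa> unfolding filterlim_at_top by blast

  have "liminf (\<lambda>n. ereal (a n / b n)) \<le>
      Liminf at_top (\<lambda>t. ereal (a (N (real (\<kappa> t) * ln 2)) / b (N (real (\<kappa> t) * ln 2))))"
    by (rule Liminf_comp_ge[OF filterlim_compose[OF N \<kappa>l]])
  also have "\<dots> \<le> Liminf at_top (\<lambda>t. ereal (G t / t))"
  proof (rule Limsup_Liminf_ge_asymp(2))
    show "((\<lambda>t. b (N (real (\<kappa> t) * ln 2)) / (real (\<kappa> t) * ln 2) * (real (\<kappa> t) * ln 2 / t)) \<longlongrightarrow> 1) at_top"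
      using tendsto_mult[OF filterlim_compose[OF bN \<kappa>l] \<kappa>t] by simp
    show "((\<lambda>t. - \<sigma> (\<kappa> t) * (real (\<kappa> t) * ln 2 / t) / ln 2) \<longlongrightarrow> 0) at_top"
      using tendsto_divide[OF tendsto_mult[OF tendsto_minus[OF filterlim_compose[OF \<sigma> \<kappa>]] \<kappa>t] tendsto_const[of "ln 2"]] by simp
    show "eventually (\<lambda>t. a (N (real (\<kappa> t) * ln 2)) / b (N (real (\<kappa> t) * ln 2)) *
        (b (N (real (\<kappa> t) * ln 2)) / (real (\<kappa> t) * ln 2) * (real (\<kappa> t) * ln 2 / t)) +
        - \<sigma> (\<kappa> t) * (real (\<kappa> t) * ln 2 / t) / ln 2 \<le> G t / t) at_top"
      using \<kappa>pos eventually_gt_at_top[of 0]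
    proof eventually_elim
      case (elim t)
      let ?s = "real (\<kappa> t) * ln 2"
      have "?s > 0" using elim by simp
      then have "b (N ?s) > 0" using Nge[of ?s] by linarith
      have "a (N ?s) / b (N ?s) * (b (N ?s) / ?s * (?s / t)) + - \<sigma> (\<kappa> t) * (?s / t) / ln 2
          = (a (N ?s) - \<sigma> (\<kappa> t) * real (\<kappa> t)) / t"
        using \<open>b (N ?s) > 0\<close> elim by (simp add: field_simps)
      also have "\<dots> = G ?s / t" using \<sigma>eq[of "\<kappa> t"] elim by simp
      also have "\<dots> \<le> G t / t"
        using elim \<kappa>le[of t] by (intro divide_right_mono monoD[OF G]) auto
      finally show ?case .
    qed
  qed
  finally have 3: "liminf (\<lambda>n. ereal (a n / b n)) \<le> Liminf at_top (\<lambda>t. ereal (G t / t))" .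

  \<comment> \<open>For the upper limit b n is rounded up instead. The scale then lies strictly
    above b n, so its first generation exceeds n and a there is at least a n.\<close>
  define K where "K = (\<lambda>n. Suc (\<kappa> (b n)))"
  have \<kappa>b: "filterlim (\<lambda>n. \<kappa> (b n)) sequentially sequentially" by (rule filterlim_compose[OF \<kappa> b])
  have K: "filterlim K sequentially sequentially"
    unfolding K_def by (rule filterlim_compose[OF filterlim_Suc \<kappa>b])
  have Kl: "filterlim (\<lambda>n. real (K n) * ln 2) at_top sequentially"
    by (rule filterlim_at_top_mult_tendsto_pos[OF tendsto_const])
      (auto intro: filterlim_compose[OF filterlim_real_sequentially K])
  have "(\<lambda>n. real (\<kappa> (b n)) * ln 2 / b n + ln 2 / b n) \<longlonglongrightarrow> 1 + 0"
    by (intro tendsto_add filterlim_compose[OF \<kappa>t b] tendsto_divide_0[OF tendsto_const]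
        filterlim_at_top_imp_at_infinity b)
  then have "(\<lambda>n. real (K n) * ln 2 / b n) \<longlonglongrightarrow> 1"
    by (simp add: K_def add_divide_distrib distrib_right add.commute)
  then have Kb: "(\<lambda>n. b n / (real (K n) * ln 2)) \<longlonglongrightarrow> 1"
    using tendsto_inverse[of "\<lambda>n. real (K n) * ln 2 / b n" 1] by (simp add: inverse_eq_divide)
  have "limsup (\<lambda>n. ereal (a n / b n)) \<le> limsup (\<lambda>n. ereal (G (real (K n) * ln 2) / (real (K n) * ln 2)))"
  proof (rule Limsup_Liminf_ge_asymp(1)[OF _ Kb])
    show "(\<lambda>n. - \<sigma> (K n) / ln 2) \<longlonglongrightarrow> 0"
      using tendsto_divide[OF tendsto_minus[OF filterlim_compose[OF \<sigma> K]] tendsto_const[of "ln 2"]] by simp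
    show "eventually (\<lambda>n. a n / b n * (b n / (real (K n) * ln 2)) + - \<sigma> (K n) / ln 2
        \<le> G (real (K n) * ln 2) / (real (K n) * ln 2)) sequentially"
      using bpos
    proof eventually_elim
      case (elim n)
      let ?s = "real (K n) * ln 2"
      have s: "b n < ?s" using \<kappa>gt[OF elim] by (simp add: K_def algebra_simps)
      with elim have "?s > 0" by linarith
      have "N ?s > n"
        using s Nge[of ?s] incseqD[OF b_mono, of "N ?s" n] by linarith
      then have an: "a n \<le> a (N ?s)" using incseqD[OF a] by simp
      have "a n / b n * (b n / ?s) + - \<sigma> (K n) / ln 2 = (a n - \<sigma> (K n) * real (K n)) / ?s"
      proof -
        have "a n / b n * (b n / ?s) = a n / ?s" using elim by simp
        moreover have "\<sigma> (K n) / ln 2 = \<sigma> (K n) * real (K n) / ?s" by (simp add: K_def)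
        ultimately show ?thesis by (simp only: diff_divide_distrib minus_divide_left[symmetric] add_uminus_conv_diff)
      qed
      also have "\<dots> \<le> (a (N ?s) - \<sigma> (K n) * real (K n)) / ?s"
        using an \<open>?s > 0\<close> by (intro divide_right_mono) auto
      also have "\<dots> = G ?s / ?s" using \<sigma>eq[of "K n"] by (simp add: K_def)
      finally show ?case .
    qed
  qed
  also have "\<dots> \<le> Limsup at_top (\<lambda>t. ereal (G t / t))"
    by (rule Limsup_comp_le[OF Kl])
  finally have 4: "limsup (\<lambda>n. ereal (a n / b n)) \<le> Limsup at_top (\<lambda>t. ereal (G t / t))" .
  show "Limsup at_top (\<lambda>t. ereal (G t / t)) = limsup (\<lambda>n. ereal (a n / b n))"
    using 1 4 by (rule antisym)
  show "Liminf at_top (\<lambda>t. ereal (G t / t)) = liminf (\<lambda>n. ereal (a n / b n))"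
    using 2 3 by (rule antisym)
qed

text \<open>Linear growth of b makes an o(n) error an o(b) error. Hence b / B tends to 1, and A / B
  = (a / b) (b / B) - ((a - A) / b) (b / B). The absolute value is there because b will be a
  logarithm of a diameter, which is eventually negative.\<close>

lemma limsup_liminf_ratio_eq:
  fixes a b A B :: "nat \<Rightarrow> real"
  assumes \<kappa>: "0 < \<kappa>" and b: "eventually (\<lambda>n. \<kappa> * real (Suc n) \<le> \<bar>b n\<bar>) sequentially"
    and A: "(\<lambda>n. (a n - A n) / real (Suc n)) \<longlonglongrightarrow> 0"
    and B: "(\<lambda>n. (b n - B n) / real (Suc n)) \<longlonglongrightarrow> 0"
  shows "limsup (\<lambda>n. ereal (A n / B n)) = limsup (\<lambda>n. ereal (a n / b n))"
    and "liminf (\<lambda>n. ereal (A n / B n)) = liminf (\<lambda>n. ereal (a n / b n))"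
proof -
  have *: "(\<lambda>n. (c n - C n) / b n) \<longlonglongrightarrow> 0" if "(\<lambda>n. (c n - C n) / real (Suc n)) \<longlonglongrightarrow> 0" for c C :: "nat \<Rightarrow> real"
  proof (rule tendsto_0_le[OF that])
    show "eventually (\<lambda>n. norm ((c n - C n) / b n) \<le> norm ((c n - C n) / real (Suc n)) * (1 / \<kappa>)) sequentially"
      using b
    proof eventually_elim
      case (elim n)
      have "0 < \<kappa> * real (Suc n)" using \<kappa> by simp
      moreover from this have "0 < \<bar>b n\<bar>" using elim by (rule less_le_trans)
      ultimately have "\<bar>c n - C n\<bar> / \<bar>b n\<bar> \<le> \<bar>c n - C n\<bar> / (\<kappa> * real (Suc n))"
        using elim \<kappa> by (intro divide_left_mono mult_pos_pos) auto
      then show ?case by (simp add: abs_divide mult.commute)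
    qed
  qed
  have bnz: "eventually (\<lambda>n. b n \<noteq> 0) sequentially"
    using b
  proof eventually_elim
    case (elim n)
    have "0 < \<kappa> * real (Suc n)" using \<kappa> by simp
    then show ?case using elim by linarith
  qed
  have "(\<lambda>n. 1 - (b n - B n) / b n) \<longlonglongrightarrow> 1 - 0" by (intro tendsto_diff tendsto_const * B)
  moreover have "eventually (\<lambda>n. 1 - (b n - B n) / b n = B n / b n) sequentially"
    using bnz by eventually_elim (simp add: diff_divide_distrib)
  ultimately have Bb: "(\<lambda>n. B n / b n) \<longlonglongrightarrow> 1" by (simp add: tendsto_cong)
  then have \<tau>: "(\<lambda>n. b n / B n) \<longlonglongrightarrow> 1"
    using tendsto_inverse[OF Bb] by (simp add: inverse_eq_divide)
  have \<sigma>: "(\<lambda>n. - ((a n - A n) / b n) * (b n / B n)) \<longlonglongrightarrow> 0"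
    using tendsto_mult[OF tendsto_minus[OF *[OF A]] \<tau>] by simp
  have eq: "eventually (\<lambda>n. A n / B n = a n / b n * (b n / B n) + - ((a n - A n) / b n) * (b n / B n)) sequentially"
    using bnz by eventually_elim (simp add: diff_divide_distrib algebra_simps)
  have 1: "eventually (\<lambda>n. A n / B n \<le> a n / b n * (b n / B n) + - ((a n - A n) / b n) * (b n / B n)) sequentially"
    using eq by eventually_elim linarith
  have 2: "eventually (\<lambda>n. a n / b n * (b n / B n) + - ((a n - A n) / b n) * (b n / B n) \<le> A n / B n) sequentially"
    using eq by eventually_elim linarith
  show "limsup (\<lambda>n. ereal (A n / B n)) = limsup (\<lambda>n. ereal (a n / b n))"
    "liminf (\<lambda>n. ereal (A n / B n)) = liminf (\<lambda>n. ereal (a n / b n))"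
    using Limsup_Liminf_le_asymp[OF 1 \<tau> \<sigma>] Limsup_Liminf_ge_asymp[OF 2 \<tau> \<sigma>] by (auto intro: antisym)
qed

text \<open>The increments from generation 0 onwards telescope to X (Suc N) - X 0, while the entropy
  sums begin at n = 1. The discrepancy X 0 + H 0 is a fixed number and disappears in the
  average.\<close>

lemma average_difference:
  fixes X H :: "nat \<Rightarrow> real"
  assumes "(\<lambda>N. (\<Sum>n<N. (X (Suc n) - X n) - H n) / real N) \<longlonglongrightarrow> 0"
  shows "(\<lambda>N. (X (Suc N) - (\<Sum>n=1..N. H n)) / real (Suc N)) \<longlonglongrightarrow> 0"
proof -
  have "(\<lambda>N. (\<Sum>n<Suc N. (X (Suc n) - X n) - H n) / real (Suc N)) \<longlonglongrightarrow> 0"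
    using assms by (rule LIMSEQ_Suc)
  moreover have "(\<lambda>N. (X 0 + H 0) / real (Suc N)) \<longlonglongrightarrow> 0"
    by real_asymp
  ultimately have "(\<lambda>N. (\<Sum>n<Suc N. (X (Suc n) - X n) - H n) / real (Suc N) + (X 0 + H 0) / real (Suc N)) \<longlonglongrightarrow> 0 + 0"
    by (rule tendsto_add)
  moreover have "(\<Sum>n<Suc N. (X (Suc n) - X n) - H n) / real (Suc N) + (X 0 + H 0) / real (Suc N)
      = (X (Suc N) - (\<Sum>n=1..N. H n)) / real (Suc N)" for N
  proof -
    have "(\<Sum>n<Suc N. H n) = H 0 + (\<Sum>n=1..N. H n)"
      by (simp only: lessThan_Suc_atMost atMost_atLeast0 sum.atLeast_Suc_atMost[OF le0]) simp
    then have "(\<Sum>n<Suc N. (X (Suc n) - X n) - H n) + (X 0 + H 0) = X (Suc N) - (\<Sum>n=1..N. H n)"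
      using sum_lessThan_telescope[of X "Suc N"] sum_subtractf[of "\<lambda>n. X (Suc n) - X n" H "{..<Suc N}"]
      by linarith
    then show ?thesis by (simp only: add_divide_distrib[symmetric])
  qed
  ultimately show ?thesis by simp
qed

text \<open>Dominated convergence for series: every term tends to 0 in m and is dominated by its
  value in the summable series. The sum is the value at the root of the supermartingale used in the
  strong law.\<close>

lemma tendsto_sum_div_max_square:
  fixes s :: "nat \<Rightarrow> real"
  assumes s: "summable (\<lambda>n. s n / (real (Suc n))\<^sup>2)" and nonneg: "\<And>n. 0 \<le> s n"
  shows "(\<lambda>m. \<Sum>k. s k / (max (real (Suc k)) (real m))\<^sup>2) \<longlonglongrightarrow> 0"
proof -
  have "(\<lambda>m. \<Sum>k. s k / (max (real (Suc k)) (real m))\<^sup>2) \<longlonglongrightarrow> (\<Sum>k. 0)"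
  proof (rule tannerys_theorem[THEN conjunct2, THEN conjunct2])
    show "(\<lambda>m. s k / (max (real (Suc k)) (real m))\<^sup>2) \<longlonglongrightarrow> 0" for k
      by real_asymp
    show "eventually (\<lambda>(k, m). norm (s k / (max (real (Suc k)) (real m))\<^sup>2) \<le> s k / (real (Suc k))\<^sup>2)
        (at_top \<times>\<^sub>F at_top)"
      using nonneg by (intro always_eventually) (auto intro!: divide_left_mono power_mono mult_pos_pos)
  qed (use s in auto)
  then show ?thesis by simp
qed

section \<open>Packings in doubling spaces\<close>

lemma doubling_iterate:
  fixes x :: "'a::metric_space"
  assumes N: "\<And>(x::'a) r. 0 < r \<Longrightarrow> \<exists>C. finite C \<and> card C \<le> N \<and> cball x r \<subseteq> (\<Union>c\<in>C. cball c (r/2))"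
    and "0 < r"
  shows "\<exists>C. finite C \<and> card C \<le> N ^ m \<and> cball x r \<subseteq> (\<Union>c\<in>C. cball c (r / 2 ^ m))"
proof (induction m)
  case 0
  show ?case by (intro exI[of _ "{x}"]) auto
next
  case (Suc m)
  then obtain C where C: "finite C" "card C \<le> N ^ m" "cball x r \<subseteq> (\<Union>c\<in>C. cball c (r / 2 ^ m))"
    by blast
  have "\<forall>c::'a. \<exists>D. finite D \<and> card D \<le> N \<and> cball c (r / 2 ^ m) \<subseteq> (\<Union>d\<in>D. cball d (r / 2 ^ m / 2))"
  proof
    fix c :: 'a
    have "0 < r / 2 ^ m" using \<open>0 < r\<close> by simp
    from N[OF this, of c] show "\<exists>D. finite D \<and> card D \<le> N \<and> cball c (r / 2 ^ m) \<subseteq> (\<Union>d\<in>D. cball d (r / 2 ^ m / 2))" .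
  qed
  from choice[OF this] obtain D where "\<forall>c::'a. finite (D c) \<and> card (D c) \<le> N \<and>
    cball c (r / 2 ^ m) \<subseteq> (\<Union>d\<in>D c. cball d (r / 2 ^ m / 2))" ..
  then have D: "finite (D c)" "card (D c) \<le> N" "cball c (r / 2 ^ m) \<subseteq> (\<Union>d\<in>D c. cball d (r / 2 ^ m / 2))" for c :: 'a
    by simp_all
  have "card (\<Union>c\<in>C. D c) \<le> (\<Sum>c\<in>C. card (D c))" using C(1) by (rule card_UN_le)
  also have "\<dots> \<le> card C * N" using sum_bounded_above[of C "\<lambda>c. card (D c)" N] D(2) by simp
  also have "\<dots> \<le> N ^ Suc m" using C(2) by (simp add: mult.commute)
  finally have "card (\<Union>c\<in>C. D c) \<le> N ^ Suc m" .
  moreover have "cball x r \<subseteq> (\<Union>d\<in>(\<Union>c\<in>C. D c). cball d (r / 2 ^ Suc m))"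
  proof
    fix y assume "y \<in> cball x r"
    then obtain c where c: "c \<in> C" "y \<in> cball c (r / 2 ^ m)" using C(3) by blast
    then obtain d where "d \<in> D c" "y \<in> cball d (r / 2 ^ m / 2)" using D(3)[of c] by blast
    with c show "y \<in> (\<Union>d\<in>(\<Union>c\<in>C. D c). cball d (r / 2 ^ Suc m))" by (auto simp: mult.commute)
  qed
  ultimately show ?case using C(1) D(1) by (intro exI[of _ "\<Union>c\<in>C. D c"]) auto
qed

text \<open>Assign to each point a covering ball of radius r / 2^m that contains it. Two points in
  one such ball are at most 2 r / 2^m apart, so the separation makes the assignment
  injective.\<close>

lemma doubling_packing:
  fixes z :: "'b \<Rightarrow> 'a::metric_space"
  assumes N: "\<And>(x::'a) r. 0 < r \<Longrightarrow> \<exists>C. finite C \<and> card C \<le> N \<and> cball x r \<subseteq> (\<Union>c\<in>C. cball c (r/2))"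
    and r: "0 < r" and P: "\<And>p. p \<in> P \<Longrightarrow> z p \<in> cball y r"
    and sep: "\<And>p q. p \<in> P \<Longrightarrow> q \<in> P \<Longrightarrow> p \<noteq> q \<Longrightarrow> 2 * r / 2 ^ m < dist (z p) (z q)"
  shows "card P \<le> N ^ m"
proof -
  obtain C where C: "finite C" "card C \<le> N ^ m" "cball y r \<subseteq> (\<Union>c\<in>C. cball c (r / 2 ^ m))"
    using doubling_iterate[OF N r, of m y] by blast
  have "\<forall>p\<in>P. \<exists>c\<in>C. z p \<in> cball c (r / 2 ^ m)" using C(3) P by blast
  then obtain f where f: "\<And>p. p \<in> P \<Longrightarrow> f p \<in> C" "\<And>p. p \<in> P \<Longrightarrow> z p \<in> cball (f p) (r / 2 ^ m)"
    by metis
  have "inj_on f P"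
  proof (rule inj_onI, rule ccontr)
    fix p q assume pq: "p \<in> P" "q \<in> P" "f p = f q" "p \<noteq> q"
    have "dist (z p) (z q) \<le> dist (f p) (z p) + dist (f p) (z q)"
      by (metis dist_commute dist_triangle)
    also have "\<dots> \<le> r / 2 ^ m + r / 2 ^ m"
      using f(2)[OF pq(1)] f(2)[OF pq(2)] pq(3) by (intro add_mono) auto
    finally show False using sep[OF pq(1,2,4)] by simp
  qed
  then have "card P \<le> card C" using C(1) f(1) by (intro card_inj_on_le) auto
  then show ?thesis using C(2) by simp
qed

section \<open>Words, cylinders and their masses\<close>

lemma length_pfx [simp]: "length (pfx w n) = n"
  by (simp add: pfx_def)

lemma pfx_0 [simp]: "pfx w 0 = []"
  by (simp add: pfx_def)

lemma pfx_Suc: "pfx w (Suc n) = pfx w n @ [w n]"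
  by (simp add: pfx_def)

lemma butlast_pfx_Suc [simp]: "butlast (pfx w (Suc n)) = pfx w n"
  by (simp add: pfx_Suc)

lemma take_pfx: "k \<le> n \<Longrightarrow> take k (pfx w n) = pfx w k"
  by (simp add: pfx_def take_map)

lemma childrenE:
  assumes "u \<in> children \<Sigma> v"
  obtains i where "u = v @ [i]" "u \<in> \<Sigma>"
  using assms by (auto simp: children_def)

lemma pfx_Suc_children: "w \<in> infwords \<Sigma> \<Longrightarrow> pfx w (Suc n) \<in> children \<Sigma> (pfx w n)"
  unfolding infwords_def children_def using pfx_Suc[of w n] by blast

lemma in_children_butlast: "u \<in> \<Sigma> \<Longrightarrow> u \<noteq> [] \<Longrightarrow> u \<in> children \<Sigma> (butlast u)"
  unfolding children_def by simp (metis append_butlast_last_id)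

text \<open>Finiteness is part of the setting; it comes from the boundedness of the root cylinder.
  That \<open>M\<close> is a measure on the limit set is expressed by a null complement.\<close>

locale moran_measure = finite_measure M
  for M :: "'a::metric_space measure" +
  fixes \<Sigma> :: "'i::countable list set" and E :: "'i list \<Rightarrow> 'a set"
  assumes moran: "moran \<Sigma> E"
    and sets_M: "sets M = sets borel"
    and null_compl: "emeasure M (space M - limit_set \<Sigma> E) = 0"
begin

lemma space_M [simp]: "space M = UNIV"
  using sets_eq_imp_space_eq[OF sets_M] by simp

lemma tree: "codetree \<Sigma>"
  using moran by (simp add: moran_def)

lemma Nil_in: "[] \<in> \<Sigma>"
  using tree by (simp add: codetree_def)

lemma butlast_in: "v \<in> \<Sigma> \<Longrightarrow> butlast v \<in> \<Sigma>"
  using tree by (cases "v = []") (auto simp: codetree_def)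

lemma finite_children: "v \<in> \<Sigma> \<Longrightarrow> finite (children \<Sigma> v)"
  using tree by (simp add: codetree_def)

lemma children_nonempty: "v \<in> \<Sigma> \<Longrightarrow> children \<Sigma> v \<noteq> {}"
  using tree by (simp add: codetree_def)

lemma take_in: "v \<in> \<Sigma> \<Longrightarrow> take k v \<in> \<Sigma>"
proof (induction v rule: rev_induct)
  case (snoc i v)
  then have "v \<in> \<Sigma>" using butlast_in[of "v @ [i]"] by simp
  then show ?case using snoc by (cases "k \<le> length v") auto
qed simp

text \<open>(M5) speaks about infinite words only. Since every word has a child, a finite word can
  be continued forever by choice, and (M5) becomes available at each finite word.\<close>

lemma extends_to_infword:
  assumes "v \<in> \<Sigma>"
  obtains w where "w \<in> infwords \<Sigma>" "pfx w (length v) = v"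
proof -
  define f where "f = (\<lambda>u. SOME u'. u' \<in> children \<Sigma> u)"
  have f: "f u \<in> children \<Sigma> u" if "u \<in> \<Sigma>" for u
    unfolding f_def using children_nonempty[OF that] by (simp add: some_in_eq)
  define g where "g = (\<lambda>n. (f ^^ n) v)"
  have g: "g n \<in> \<Sigma> \<and> length (g n) = length v + n" for n
  proof (induction n)
    case (Suc n)
    then show ?case using f[of "g n"] by (auto simp: g_def elim!: childrenE)
  qed (simp add: g_def assms)
  have gS: "\<exists>i. g (Suc n) = g n @ [i]" for n
    using f[of "g n"] g[of n] by (auto simp: g_def elim!: childrenE)
  define w where "w = (\<lambda>n. if n < length v then v ! n else last (g (Suc n - length v)))"
  have wv: "pfx w (length v) = v"
    by (rule nth_equalityI) (auto simp: pfx_def w_def)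
  have wg: "pfx w (length v + n) = g n" for n
  proof (induction n)
    case 0
    show ?case using wv by (simp add: g_def)
  next
    case (Suc n)
    obtain i where i: "g (Suc n) = g n @ [i]" using gS by blast
    have "w (length v + n) = i" by (simp add: w_def i)
    then show ?case using Suc i by (simp add: pfx_Suc)
  qed
  have "pfx w n \<in> \<Sigma>" for n
  proof (cases "n \<le> length v")
    case True
    then show ?thesis using take_pfx[OF True, of w] wv take_in[OF assms, of n] by simp
  next
    case False
    then show ?thesis using wg[of "n - length v"] g[of "n - length v"] by simp
  qed
  then show thesis using that wv by (auto simp: infwords_def)
qed

lemma compact_E: "v \<in> \<Sigma> \<Longrightarrow> compact (E v)"
  and diam_pos: "v \<in> \<Sigma> \<Longrightarrow> 0 < diameter (E v)"
  using moran by (auto simp: moran_def)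

lemma sets_E [measurable]: "v \<in> \<Sigma> \<Longrightarrow> E v \<in> sets M"
  unfolding sets_M by (intro borel_closed compact_imp_closed compact_E)

lemma sets_UN_E: "U \<subseteq> \<Sigma> \<Longrightarrow> (\<Union>u\<in>U. E u) \<in> sets M"
  by (intro sets.countable_UN') (auto intro: sets_E)

lemma sets_cball [measurable]: "cball x r \<in> sets M"
  unfolding sets_M by simp

lemma child_subset: "u \<in> children \<Sigma> v \<Longrightarrow> E u \<subseteq> E v"
  using moran by (auto simp: moran_def children_def) (metis Nil_is_append_conv butlast_snoc insert_not_empty list.distinct(1) subset_iff)

lemma take_subset: "v \<in> \<Sigma> \<Longrightarrow> E v \<subseteq> E (take k v)"
proof (induction v rule: rev_induct)
  case (snoc i v)
  have v: "v \<in> \<Sigma>" using butlast_in[OF snoc.prems] by simp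
  then have "E (v @ [i]) \<subseteq> E v"
    using snoc.prems by (intro child_subset) (auto simp: children_def)
  then show ?case using snoc.IH[OF v] by (cases "k \<le> length v") auto
qed simp

lemma prefix_subset: "v \<in> \<Sigma> \<Longrightarrow> prefix u v \<Longrightarrow> E v \<subseteq> E u"
  using take_subset[of v "length u"] by (auto simp: prefix_def)

text \<open>By nesting a common point also lies in both parents, which agree by induction; (M3) then
  forces the last letters to agree.\<close>

lemma level_disjoint:
  assumes "u \<in> \<Sigma>" "v \<in> \<Sigma>" "length u = length v" "x \<in> E u" "x \<in> E v"
  shows "u = v"
  using assms(3,1,2,4,5)
proof (induction u v rule: rev_induct2)
  case (4 i u j v)
  then have u: "u \<in> \<Sigma>" "v \<in> \<Sigma>" using butlast_in[of "u @ [i]"] butlast_in[of "v @ [j]"] by auto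
  have "E (u @ [i]) \<subseteq> E u" "E (v @ [j]) \<subseteq> E v"
    using 4 by (auto intro!: child_subset simp: children_def)
  then have "u = v" using 4 u by (intro 4) auto
  then show ?case using 4 moran unfolding moran_def by blast
qed auto

text \<open>Cutting the longer word to the length of the shorter one keeps x in the cylinder, so
  disjointness within a level applies.\<close>

lemma comparable:
  assumes "u \<in> \<Sigma>" "v \<in> \<Sigma>" "x \<in> E u" "x \<in> E v"
  shows "prefix u v \<or> prefix v u"
proof -
  have *: "prefix u v" if "length u \<le> length v" "u \<in> \<Sigma>" "v \<in> \<Sigma>" "x \<in> E u" "x \<in> E v" for u v
  proof -
    have "u = take (length u) v"
      using that take_in take_subset[of v] by (intro level_disjoint) auto
    then show ?thesis using take_is_prefix by metis
  qed
  show ?thesis using *[of u v] *[of v u] assms by linarith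
qed

lemma AE_limit_set: "AE x in M. x \<in> limit_set \<Sigma> E"
proof -
  have "UNIV \<in> sets M" using sets.top[of M] by simp
  then show ?thesis
    by (intro AE_I[OF _ null_compl])
      (auto intro!: sets.Diff sets.countable_INT'' sets_UN_E simp: limit_set_def level_def)
qed

text \<open>The children need not cover E v; they do so up to a null set because \<open>M\<close>
  lives on the limit set. A point of the limit set in E v lies in a cylinder one generation deeper,
  and that word must extend v.\<close>

lemma measure_children:
  assumes v: "v \<in> \<Sigma>"
  shows "measure M (E v) = (\<Sum>u\<in>children \<Sigma> v. measure M (E u))"
proof -
  have "AE x in M. x \<in> E v \<longleftrightarrow> x \<in> (\<Union>u\<in>children \<Sigma> v. E u)"
    using AE_limit_set
  proof eventually_elim
    case (elim x)
    show ?case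
    proof
      assume x: "x \<in> E v"
      obtain u where u: "u \<in> \<Sigma>" "length u = Suc (length v)" "x \<in> E u"
        using elim by (auto simp: limit_set_def level_def)
      have "prefix v u" using comparable[OF v u(1) x u(3)] u(2) by (auto dest: prefix_length_le)
      then obtain t where "u = v @ t" by (auto simp: prefix_def)
      with u have "u \<in> children \<Sigma> v" by (auto simp: children_def length_Suc_conv)
      then show "x \<in> (\<Union>u\<in>children \<Sigma> v. E u)" using u by blast
    next
      assume "x \<in> (\<Union>u\<in>children \<Sigma> v. E u)"
      then show "x \<in> E v" using child_subset by blast
    qed
  qed
  then have "measure M (E v) = measure M (\<Union>u\<in>children \<Sigma> v. E u)"
    using v by (intro finite_measure_eq_AE) (auto intro!: sets_UN_E simp: children_def)
  also have "\<dots> = (\<Sum>u\<in>children \<Sigma> v. measure M (E u))"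
  proof (rule finite_measure_finite_Union)
    show "disjoint_family_on E (children \<Sigma> v)"
      using level_disjoint by (fastforce simp: disjoint_family_on_def children_def)
  qed (use finite_children[OF v] in \<open>auto simp: children_def\<close>)
  finally show ?thesis .
qed

text \<open>If E v has mass 0, so has E u, and the identity persists with the default value 0 of the
  quotient.\<close>

lemma measure_child:
  assumes v: "v \<in> \<Sigma>" and u: "u \<in> children \<Sigma> v"
  shows "measure M (E u) = measure M (E v) * pw M E u"
proof -
  have "measure M (E u) \<le> measure M (E v)"
    using v by (intro finite_measure_mono child_subset u) auto
  moreover have "u \<noteq> []" "butlast u = v" using u by (auto simp: children_def)
  ultimately show ?thesis by (cases "measure M (E v) = 0") (auto simp: pw_def order_antisym)
qed

lemma sum_pw:
  assumes v: "v \<in> \<Sigma>" and "measure M (E v) \<noteq> 0"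
  shows "(\<Sum>u\<in>children \<Sigma> v. pw M E u) = 1"
proof -
  have "measure M (E v) * (\<Sum>u\<in>children \<Sigma> v. pw M E u) = (\<Sum>u\<in>children \<Sigma> v. measure M (E u))"
    unfolding sum_distrib_left by (intro sum.cong refl measure_child[OF v, symmetric])
  also have "\<dots> = measure M (E v) * 1" using measure_children[OF v] by simp
  finally have "measure M (E v) * (\<Sum>u\<in>children \<Sigma> v. pw M E u) = measure M (E v) * 1" .
  then show ?thesis using assms(2) by simp
qed

lemma pw_nonneg: "0 \<le> pw M E v"
  by (simp add: pw_def)

lemma coding_setD: "x \<in> coding_set E w \<Longrightarrow> x \<in> E (pfx w n)"
  by (auto simp: coding_set_def)

lemma infwordsD: "w \<in> infwords \<Sigma> \<Longrightarrow> pfx w n \<in> \<Sigma>"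
  by (auto simp: infwords_def)

text \<open>There are countably many words, so the cylinders of mass 0 have a null union. Off this
  union all logarithms of cylinder masses along a branch are genuine.\<close>

lemma AE_pos: "AE x in M. \<forall>v\<in>\<Sigma>. x \<in> E v \<longrightarrow> 0 < measure M (E v)"
proof -
  have "AE x in M. \<forall>v\<in>{v \<in> \<Sigma>. measure M (E v) = 0}. x \<notin> E v"
  proof (subst AE_ball_countable)
    show "\<forall>v\<in>{v \<in> \<Sigma>. measure M (E v) = 0}. AE x in M. x \<notin> E v"
      by (auto intro!: AE_not_in simp: null_sets_def emeasure_eq_measure)
  qed auto
  then show ?thesis by eventually_elim (auto simp: zero_less_measure_iff)
qed

section \<open>A strong law of large numbers along the tree\<close>

text \<open>Maximal inequality for a nonnegative supermartingale V, by induction on the depth k. If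
  V has reached l at v, the whole cylinder is paid for by V v; otherwise the bad set lies below the
  children, and the supermartingale property adds up their bounds. The start v is arbitrary so that
  the induction can descend.\<close>

lemma maximal_inequality_step:
  fixes V :: "'i list \<Rightarrow> real"
  assumes V: "\<And>v. v \<in> \<Sigma> \<Longrightarrow> 0 \<le> V v"
    and super: "\<And>v. v \<in> \<Sigma> \<Longrightarrow> (\<Sum>u\<in>children \<Sigma> v. measure M (E u) * V u) \<le> measure M (E v) * V v"
    and "0 < l" "v \<in> \<Sigma>"
  shows "l * measure M (\<Union>u\<in>{u \<in> \<Sigma>. prefix v u \<and> length u \<le> length v + k \<and> l \<le> V u}. E u)
      \<le> measure M (E v) * V v"
  using \<open>v \<in> \<Sigma>\<close>
proof (induction k arbitrary: v)
  case (0 v)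
  define A where "A = (\<Union>u\<in>{u \<in> \<Sigma>. prefix v u \<and> length u \<le> length v + 0 \<and> l \<le> V u}. E u)"
  have u: "u = v" if "prefix v u" "length u \<le> length v + 0" for u
    using that by (auto simp: prefix_def)
  show ?case
  proof (cases "l \<le> V v")
    case True
    have "measure M A \<le> measure M (E v)"
      unfolding A_def using u 0 by (intro finite_measure_mono) auto
    then have "l * measure M A \<le> V v * measure M (E v)" using True \<open>0 < l\<close> by (intro mult_mono) auto
    then show ?thesis by (simp add: A_def mult.commute)
  next
    case False
    then have "A = {}" using u by (auto simp: A_def)
    then show ?thesis using V[OF 0] by (simp add: A_def)
  qed
next
  case (Suc k v)
  define A where "A = (\<lambda>v k. \<Union>u\<in>{u \<in> \<Sigma>. prefix v u \<and> length u \<le> length v + k \<and> l \<le> V u}. E u)"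
  have IH: "l * measure M (A u k) \<le> measure M (E u) * V u" if "u \<in> \<Sigma>" for u
    using Suc.IH[OF that] by (simp add: A_def)
  have "l * measure M (A v (Suc k)) \<le> measure M (E v) * V v"
  proof (cases "l \<le> V v")
    case True
    have "measure M (A v (Suc k)) \<le> measure M (E v)"
      unfolding A_def using Suc.prems prefix_subset by (intro finite_measure_mono sets_E) blast+
    then have "l * measure M (A v (Suc k)) \<le> V v * measure M (E v)"
      using True \<open>0 < l\<close> by (intro mult_mono) auto
    then show ?thesis by (simp add: mult.commute)
  next
    case False
    have "A v (Suc k) \<subseteq> (\<Union>c\<in>children \<Sigma> v. A c k)"
    proof
      fix x assume "x \<in> A v (Suc k)"
      then obtain u where u: "u \<in> \<Sigma>" "prefix v u" "length u \<le> length v + Suc k" "l \<le> V u" "x \<in> E u"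
        by (auto simp: A_def)
      with False have "u \<noteq> v" by auto
      then obtain i t where t: "u = v @ i # t" using u(2) by (metis append_Nil2 neq_Nil_conv prefixE)
      then have "v @ [i] \<in> \<Sigma>" using take_in[OF u(1), of "Suc (length v)"] by simp
      then have "v @ [i] \<in> children \<Sigma> v" by (simp add: children_def)
      moreover have "x \<in> A (v @ [i]) k" using u t by (auto simp: A_def intro!: bexI[of _ u])
      ultimately show "x \<in> (\<Union>c\<in>children \<Sigma> v. A c k)" by blast
    qed
    moreover have "A c k \<in> sets M" for c k unfolding A_def by (rule sets_UN_E) auto
    ultimately have "measure M (A v (Suc k)) \<le> (\<Sum>c\<in>children \<Sigma> v. measure M (A c k))"
      using finite_children[OF Suc.prems]
      by (intro order_trans[OF finite_measure_mono finite_measure_subadditive_finite]) auto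
    then have "l * measure M (A v (Suc k)) \<le> (\<Sum>c\<in>children \<Sigma> v. l * measure M (A c k))"
      using \<open>0 < l\<close> by (simp flip: sum_distrib_left)
    also have "\<dots> \<le> (\<Sum>c\<in>children \<Sigma> v. measure M (E c) * V c)"
      by (intro sum_mono IH) (auto simp: children_def)
    also have "\<dots> \<le> measure M (E v) * V v" by (rule super[OF Suc.prems])
    finally show ?thesis .
  qed
  then show ?case by (simp add: A_def)
qed

text \<open>The bound at the root does not depend on the depth, so continuity from below extends it
  to all generations at once.\<close>

lemma maximal_inequality:
  fixes V :: "'i list \<Rightarrow> real"
  assumes V: "\<And>v. v \<in> \<Sigma> \<Longrightarrow> 0 \<le> V v"
    and super: "\<And>v. v \<in> \<Sigma> \<Longrightarrow> (\<Sum>u\<in>children \<Sigma> v. measure M (E u) * V u) \<le> measure M (E v) * V v"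
    and l: "0 < l"
  shows "l * measure M (\<Union>u\<in>{u \<in> \<Sigma>. l \<le> V u}. E u) \<le> measure M (E []) * V []"
proof -
  define A where "A = (\<lambda>k. \<Union>u\<in>{u \<in> \<Sigma>. length u \<le> k \<and> l \<le> V u}. E u)"
  have le: "l * measure M (A k) \<le> measure M (E []) * V []" for k
    using maximal_inequality_step[OF assms Nil_in, of k] by (simp add: A_def)
  have "(\<lambda>k. measure M (A k)) \<longlonglongrightarrow> measure M (\<Union>k. A k)"
  proof (rule finite_Lim_measure_incseq)
    show "range A \<subseteq> sets M" by (auto simp: A_def intro!: sets_UN_E)
    show "incseq A" by (fastforce simp: A_def incseq_def)
  qed
  moreover have "(\<Union>k. A k) = (\<Union>u\<in>{u \<in> \<Sigma>. l \<le> V u}. E u)" by (auto simp: A_def)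
  ultimately have "(\<lambda>k. l * measure M (A k)) \<longlonglongrightarrow> l * measure M (\<Union>u\<in>{u \<in> \<Sigma>. l \<le> V u}. E u)"
    by (auto intro: tendsto_mult_left)
  then show ?thesis by (rule LIMSEQ_le_const2) (use le in auto)
qed

text \<open>One-step variance computation: with weights of sum 1 the mixed term with the centred
  increment vanishes, and the variance is at most the second moment. If E v has mass 0 the weights
  do not sum to 1, but then both sides are 0.\<close>

lemma centered_increments:
  fixes g :: "'i list \<Rightarrow> real"
  assumes v: "v \<in> \<Sigma>"
    and s: "(\<Sum>u\<in>children \<Sigma> v. pw M E u * (g u)\<^sup>2) \<le> s"
  defines "h \<equiv> (\<Sum>u\<in>children \<Sigma> v. pw M E u * g u)"
  shows "(\<Sum>u\<in>children \<Sigma> v. measure M (E u) * (c + (g u - h))\<^sup>2) \<le> measure M (E v) * (c\<^sup>2 + s)"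
proof (cases "measure M (E v) = 0")
  case True
  then show ?thesis using measure_child[OF v] by simp
next
  case False
  let ?C = "children \<Sigma> v"
  note p = sum_pw[OF v False]
  have "(\<Sum>u\<in>?C. pw M E u * (c + (g u - h))\<^sup>2)
      = (\<Sum>u\<in>?C. pw M E u * (g u)\<^sup>2 + 2 * (c - h) * (pw M E u * g u) + (c - h)\<^sup>2 * pw M E u)"
    by (intro sum.cong refl) (simp add: power2_eq_square algebra_simps)
  also have "\<dots> = (\<Sum>u\<in>?C. pw M E u * (g u)\<^sup>2) + 2 * (c - h) * h + (c - h)\<^sup>2"
    by (simp add: sum.distrib p h_def flip: sum_distrib_left)
  also have "\<dots> = (\<Sum>u\<in>?C. pw M E u * (g u)\<^sup>2) + c\<^sup>2 - h\<^sup>2"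
    by (simp add: power2_eq_square algebra_simps)
  also have "\<dots> \<le> c\<^sup>2 + s" using s zero_le_power2[of h] by linarith
  finally have "measure M (E v) * (\<Sum>u\<in>?C. pw M E u * (c + (g u - h))\<^sup>2) \<le> measure M (E v) * (c\<^sup>2 + s)"
    by (intro mult_left_mono) auto
  moreover have "(\<Sum>u\<in>?C. measure M (E u) * (c + (g u - h))\<^sup>2)
      = measure M (E v) * (\<Sum>u\<in>?C. pw M E u * (c + (g u - h))\<^sup>2)"
    unfolding sum_distrib_left by (intro sum.cong refl) (simp add: measure_child[OF v])
  ultimately show ?thesis by simp
qed

text \<open>With deterministic bounds \<open>s n\<close> on the conditional variances, the squared partial sum
  divided by \<open>max n m\<close> squared becomes a supermartingale once the remaining variance
  \<open>R m n\<close> is added (a Hajek-Renyi argument).\<close>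
lemma strong_law:
  fixes g :: "'i list \<Rightarrow> real"
  assumes s: "\<And>v. v \<in> \<Sigma> \<Longrightarrow> (\<Sum>u\<in>children \<Sigma> v. pw M E u * (g u)\<^sup>2) \<le> s (length v)"
    and s_nonneg: "\<And>n. 0 \<le> s n"
    and summable: "summable (\<lambda>n. s n / (real (Suc n))\<^sup>2)"
  shows "AE x in M. \<forall>w\<in>infwords \<Sigma>. x \<in> coding_set E w \<longrightarrow>
    (\<lambda>N. (\<Sum>n<N. g (pfx w (Suc n)) - (\<Sum>u\<in>children \<Sigma> (pfx w n). pw M E u * g u)) / real N) \<longlonglongrightarrow> 0"
proof -
  define h where "h = (\<lambda>v. \<Sum>u\<in>children \<Sigma> v. pw M E u * g u)"
  define S where "S = (\<lambda>v. \<Sum>n<length v. g (take (Suc n) v) - h (take n v))"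
  \<comment> \<open>The term \<open>r m k\<close> pays for the variance added in passing from length
    k to length k + 1, hence \<open>Suc k\<close>. The floor m does not affect words of length at
    least m, and it drives the total cost to 0 as m grows.\<close>
  define r where "r = (\<lambda>m k. s k / (max (real (Suc k)) (real m))\<^sup>2)"
  define R where "R = (\<lambda>m n. \<Sum>k. r m (k + n))"
  define V where "V = (\<lambda>m v. (S v)\<^sup>2 / (max (real (length v)) (real m))\<^sup>2 + R m (length v))"
  have r_nonneg: "0 \<le> r m k" for m k using s_nonneg by (simp add: r_def)
  have r_le: "r m k \<le> s k / (real (Suc k))\<^sup>2" for m k
    unfolding r_def using s_nonneg by (intro divide_left_mono power_mono mult_pos_pos) auto
  have r_sum: "summable (r m)" for m
    by (rule summable_comparison_test'[OF summable]) (use r_nonneg r_le in auto)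
  have R_nonneg: "0 \<le> R m n" for m n
    unfolding R_def using r_nonneg by (intro suminf_nonneg summable_ignore_initial_segment r_sum)
  have R_Suc: "R m n = r m n + R m (Suc n)" for m n
    using suminf_split_head[OF summable_ignore_initial_segment[OF r_sum[of m], of n]] by (simp add: R_def)
  have V_nonneg: "0 \<le> V m v" for m v using R_nonneg by (simp add: V_def)
  have S_child: "S u = S v + (g u - h v)" if "u \<in> children \<Sigma> v" for u v
    using that by (auto simp: S_def children_def)
  have super: "(\<Sum>u\<in>children \<Sigma> v. measure M (E u) * V m u) \<le> measure M (E v) * V m v"
    if v: "v \<in> \<Sigma>" for m v
  proof -
    define n where "n = length v"
    define b where "b = (max (real (Suc n)) (real m))\<^sup>2"
    have b: "0 < b" by (simp add: b_def max_def)
    have bounds: "(max (real n) (real m))\<^sup>2 \<le> b" unfolding b_def by (intro power_mono) auto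
    have "(\<Sum>u\<in>children \<Sigma> v. measure M (E u) * V m u)
        = (\<Sum>u\<in>children \<Sigma> v. measure M (E u) * (S v + (g u - h v))\<^sup>2 / b + measure M (E u) * R m (Suc n))"
    proof (intro sum.cong refl)
      fix u assume u: "u \<in> children \<Sigma> v"
      then have "length u = Suc n" by (auto simp: children_def n_def)
      then show "measure M (E u) * V m u =
          measure M (E u) * (S v + (g u - h v))\<^sup>2 / b + measure M (E u) * R m (Suc n)"
        by (simp add: V_def S_child[OF u] b_def distrib_left)
    qed
    also have "\<dots> = (\<Sum>u\<in>children \<Sigma> v. measure M (E u) * (S v + (g u - h v))\<^sup>2) / b
        + measure M (E v) * R m (Suc n)"
      by (simp add: sum.distrib sum_divide_distrib sum_distrib_right measure_children[OF v])
    also have "\<dots> \<le> measure M (E v) * ((S v)\<^sup>2 + s n) / b + measure M (E v) * R m (Suc n)"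
      unfolding h_def n_def using b by (intro add_right_mono divide_right_mono centered_increments v s) auto
    also have "\<dots> = measure M (E v) * ((S v)\<^sup>2 / b + R m n)"
      unfolding R_Suc[of m n] by (simp add: r_def b_def add_divide_distrib distrib_left)
    also have "\<dots> \<le> measure M (E v) * V m v"
    proof (intro mult_left_mono)
      have "(S v)\<^sup>2 / b \<le> (S v)\<^sup>2 / (max (real n) (real m))\<^sup>2"
      proof (cases "max (real n) (real m) = 0")
        \<comment> \<open>At the root with m = 0 the denominator is 0. The inequality survives
          because the partial sum at the root is empty and division by 0 yields 0.\<close>
        case True
        then have "v = []" by (simp add: n_def max_def split: if_splits)
        then have "S v = 0" by (simp add: S_def)
        then show ?thesis by simp
      next
        case False
        then show ?thesis using bounds b by (intro divide_left_mono mult_pos_pos) auto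
      qed
      then show "(S v)\<^sup>2 / b + R m n \<le> V m v" by (simp add: V_def n_def)
    qed auto
    finally show ?thesis .
  qed
  have V_Nil: "V m [] = (\<Sum>k. r m k)" for m by (simp add: V_def S_def R_def)
  have lim: "(\<lambda>m. \<Sum>k. r m k) \<longlonglongrightarrow> 0"
    unfolding r_def by (rule tendsto_sum_div_max_square[OF summable s_nonneg])
  define Q where "Q = (\<lambda>l m. \<Union>v\<in>{v \<in> \<Sigma>. l \<le> V m v}. E v)"
  have Q_sets: "Q l m \<in> sets M" for l m unfolding Q_def by (rule sets_UN_E) auto
  \<comment> \<open>A point lying in \<open>Q l m\<close> for all m belongs to sets whose mass
    bounds tend to 0. For any other point a single m controls all later generations.\<close>
  have "AE x in M. \<exists>m. x \<notin> Q l m" if l: "0 < l" for l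
  proof -
    have "measure M (\<Inter>m. Q l m) \<le> measure M (E []) * (\<Sum>k. r m k) / l" for m
    proof -
      have "measure M (\<Inter>m. Q l m) \<le> measure M (Q l m)"
        using Q_sets by (intro finite_measure_mono) auto
      also have "\<dots> \<le> measure M (E []) * (\<Sum>k. r m k) / l"
        using maximal_inequality[of "V m" l] super V_nonneg l V_Nil
        by (simp add: Q_def pos_le_divide_eq mult.commute)
      finally show ?thesis .
    qed
    moreover have "(\<lambda>m. measure M (E []) * (\<Sum>k. r m k) / l) \<longlonglongrightarrow> measure M (E []) * 0 / l"
      using l by (intro tendsto_intros lim) auto
    ultimately have "measure M (\<Inter>m. Q l m) \<le> 0"
      using LIMSEQ_le_const[of _ "measure M (E []) * 0 / l" "measure M (\<Inter>m. Q l m)"] by auto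
    then have "(\<Inter>m. Q l m) \<in> null_sets M"
      using Q_sets by (auto simp: null_sets_def emeasure_eq_measure intro: order_antisym)
    then have "AE x in M. x \<notin> (\<Inter>m. Q l m)" by (rule AE_not_in)
    then show ?thesis by eventually_elim auto
  qed
  \<comment> \<open>\<open>V\<close> dominates the square of the average, so the thresholds are
    squares; a countable family of them leaves one common null set.\<close>
  then have "AE x in M. \<forall>i. \<exists>m. x \<notin> Q (inverse (real (Suc i)) ^ 2) m"
    by (subst AE_all_countable) simp
  then show ?thesis
  proof eventually_elim
    case (elim x)
    show ?case
    proof (intro ballI impI LIMSEQ_I)
      fix w \<epsilon> assume w: "w \<in> infwords \<Sigma>" "x \<in> coding_set E w" and \<epsilon>: "0 < (\<epsilon>::real)"
      obtain i where i: "inverse (real (Suc i)) < \<epsilon>" using reals_Archimedean[OF \<epsilon>] by blast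
      let ?e = "inverse (real (Suc i))"
      obtain m where m: "x \<notin> Q (?e\<^sup>2) m" using elim by blast
      have "\<bar>S (pfx w n) / real n\<bar> < \<epsilon>" if n: "n \<ge> Suc m" for n
      proof -
        have "V m (pfx w n) < ?e\<^sup>2"
          using m infwordsD[OF w(1), of n] coding_setD[OF w(2), of n] by (force simp: Q_def)
        then have "(S (pfx w n))\<^sup>2 / (max (real n) (real m))\<^sup>2 < ?e\<^sup>2"
          using R_nonneg[of m n] by (simp add: V_def)
        moreover have "max (real n) (real m) = real n" using n by simp
        ultimately have "(S (pfx w n) / real n)\<^sup>2 < ?e\<^sup>2" by (simp add: power_divide)
        then have "\<bar>S (pfx w n) / real n\<bar>\<^sup>2 < ?e\<^sup>2" by (simp only: power2_abs)
        then have "\<bar>S (pfx w n) / real n\<bar> < ?e" by (rule power2_less_imp_less) simp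
        then show ?thesis using i by linarith
      qed
      moreover have "S (pfx w N) = (\<Sum>n<N. g (pfx w (Suc n)) - (\<Sum>u\<in>children \<Sigma> (pfx w n). pw M E u * g u))" for N
        unfolding S_def h_def by (intro sum.cong) (simp_all add: take_pfx)
      ultimately show "\<exists>no. \<forall>n\<ge>no. norm ((\<Sum>n<n. g (pfx w (Suc n)) -
          (\<Sum>u\<in>children \<Sigma> (pfx w n). pw M E u * g u)) / real n - 0) < \<epsilon>"
        by (intro exI[of _ "Suc m"]) simp
    qed
  qed
qed

section \<open>Local dimensions via cylinders\<close>

lemma finite_level: "finite (level \<Sigma> n)"
proof (induction n)
  case (Suc n)
  have "level \<Sigma> (Suc n) \<subseteq> (\<Union>v\<in>level \<Sigma> n. children \<Sigma> v)"
  proof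
    fix u assume u: "u \<in> level \<Sigma> (Suc n)"
    then have "butlast u \<in> level \<Sigma> n" using butlast_in by (auto simp: level_def)
    moreover have "u \<noteq> []" using u by (auto simp: level_def)
    then have "u \<in> children \<Sigma> (butlast u)"
      using u by (intro in_children_butlast) (auto simp: level_def)
    ultimately show "u \<in> (\<Union>v\<in>level \<Sigma> n. children \<Sigma> v)" by blast
  qed
  moreover have "finite (\<Union>v\<in>level \<Sigma> n. children \<Sigma> v)"
    using Suc finite_children by (auto simp: level_def)
  ultimately show ?case by (rule finite_subset)
qed (auto simp: level_def intro: finite_subset[of _ "{[]}"])

lemma finite_length_le: "finite {v \<in> \<Sigma>. length v \<le> n}"
proof -
  have "{v \<in> \<Sigma>. length v \<le> n} = (\<Union>k\<le>n. level \<Sigma> k)" by (auto simp: level_def)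
  then show ?thesis using finite_level by simp
qed

section \<open>Cylinders of a given dyadic scale\<close>

text \<open>Diameters decrease along branches, so a comparison with the parent alone expresses first
  passage. The root never stops; the set is empty while (1/2)^k is at least the diameter of the root
  cylinder.\<close>

definition stopping :: "nat \<Rightarrow> 'i list set" where
  "stopping k = {v \<in> \<Sigma>. v \<noteq> [] \<and> diameter (E v) \<le> (1/2) ^ k \<and> (1/2) ^ k < diameter (E (butlast v))}"

lemma diameter_prefix: "v \<in> \<Sigma> \<Longrightarrow> prefix u v \<Longrightarrow> diameter (E v) \<le> diameter (E u)"
  using take_in[of v "length u"]
  by (intro diameter_subset prefix_subset compact_imp_bounded compact_E) (auto simp: prefix_def)

text \<open>Intersecting cylinders have comparable words. If v properly extended u, the parent of v
  would still extend u and have diameter at most (1/2)^k, so v would not stop at this scale.\<close>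

lemma stopping_disjoint:
  assumes "u \<in> stopping k" "v \<in> stopping k" "u \<noteq> v"
  shows "E u \<inter> E v = {}"
proof -
  have *: False if "u \<in> stopping k" "v \<in> stopping k" "u \<noteq> v" "prefix u v" for u v
  proof -
    have "v = butlast v @ [last v]" using that(2) by (simp add: stopping_def)
    then have "prefix u (butlast v)" using that(3,4) by (metis prefix_snoc)
    then have "diameter (E (butlast v)) \<le> diameter (E u)"
      using that by (intro diameter_prefix butlast_in) (auto simp: stopping_def)
    then show False using that by (auto simp: stopping_def)
  qed
  show ?thesis
  proof (rule ccontr)
    assume "E u \<inter> E v \<noteq> {}"
    then have "prefix u v \<or> prefix v u" using comparable assms unfolding stopping_def by blast
    then show False using *[of u v] *[of v u] assms by auto
  qed
qed

lemma Min_children_le: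
  assumes "v \<in> \<Sigma>" "u \<in> children \<Sigma> v"
  shows "Min (diameter ` E ` children \<Sigma> v) \<le> diameter (E u)"
    and "0 < Min (diameter ` E ` children \<Sigma> v)"
proof -
  let ?m = "Min (diameter ` E ` children \<Sigma> v)"
  show "?m \<le> diameter (E u)" using finite_children[OF assms(1)] assms(2) by (intro Min_le) auto
  have "?m \<in> diameter ` E ` children \<Sigma> v"
    using finite_children children_nonempty assms(1) by (intro Min_in) auto
  then show "0 < ?m" using diam_pos by (auto simp: children_def)
qed

lemma uniform_diameter_ratio:
  assumes "0 < \<epsilon>"
  shows "\<exists>N. \<forall>n\<ge>N. \<forall>w\<in>infwords \<Sigma>.
    \<bar>ln (diameter (E (pfx w n))) / ln (Min (diameter ` E ` children \<Sigma> (pfx w n))) - 1\<bar> < \<epsilon>"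
  using moran assms unfolding moran_def by blast

text \<open>The parent of a stopped word still has diameter above (1/2)^k, and (M5) at the parent
  bounds from below the logarithm of the smallest child diameter. Uniformity of (M5) gives one
  threshold k for all stopped words.\<close>

lemma stopping_diameter:
  assumes \<eta>: "0 < \<eta>"
  shows "eventually (\<lambda>k. \<forall>v\<in>stopping k. 2 powr (- (1 + \<eta>) * real k) \<le> diameter (E v)) sequentially"
proof -
  \<comment> \<open>Chosen so that dividing by 1 - \<epsilon> is the same as multiplying by 1 +
    \<eta>.\<close>
  define \<epsilon> where "\<epsilon> = \<eta> / (1 + \<eta>)"
  have \<epsilon>: "0 < \<epsilon>" "(1 - \<epsilon>) * (1 + \<eta>) = 1" "\<epsilon> < 1" using \<eta> by (auto simp: \<epsilon>_def field_simps)
  obtain N where N: "\<And>n w. n \<ge> N \<Longrightarrow> w \<in> infwords \<Sigma> \<Longrightarrow>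
    \<bar>ln (diameter (E (pfx w n))) / ln (Min (diameter ` E ` children \<Sigma> (pfx w n))) - 1\<bar> < \<epsilon>"
    using uniform_diameter_ratio[OF \<epsilon>(1)] by blast
  \<comment> \<open>Words of length at most N, where (M5) is not yet effective, are finitely many.
    Once (1/2)^k is below all their diameters none of them has stopped.\<close>
  define d where "d = Min ((\<lambda>v. diameter (E v)) ` {v \<in> \<Sigma>. length v \<le> N})"
  have "d \<in> (\<lambda>v. diameter (E v)) ` {v \<in> \<Sigma>. length v \<le> N}"
    unfolding d_def using finite_length_le Nil_in by (intro Min_in) auto
  then have "0 < d" using diam_pos by auto
  have d_le: "d \<le> diameter (E v)" if "v \<in> \<Sigma>" "length v \<le> N" for v
    unfolding d_def using finite_length_le that by (intro Min_le) auto
  have "(\<lambda>k. (1/2) ^ k :: real) \<longlonglongrightarrow> 0" by (rule LIMSEQ_power_zero) simp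
  then have "eventually (\<lambda>k. (1/2) ^ k < d) sequentially" using \<open>0 < d\<close> by (rule order_tendstoD)
  then show ?thesis using eventually_gt_at_top[of 0]
  proof eventually_elim
    case (elim k)
    show ?case
    proof
      fix v assume v: "v \<in> stopping k"
      define u where "u = butlast v"
      have vS: "v \<in> \<Sigma>" "v \<noteq> []" and dv: "diameter (E v) \<le> (1/2) ^ k" and du: "(1/2) ^ k < diameter (E u)"
        using v by (auto simp: stopping_def u_def)
      have u: "u \<in> \<Sigma>" unfolding u_def by (rule butlast_in[OF vS(1)])
      have vu: "v \<in> children \<Sigma> u"
        unfolding u_def by (rule in_children_butlast[OF vS])
      have "N < length v"
      proof (rule ccontr)
        assume "\<not> N < length v"
        then have "d \<le> diameter (E v)" using d_le[OF vS(1)] by simp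
        then show False using dv elim by linarith
      qed
      then have Nu: "N \<le> length u" by (simp add: u_def)
      obtain w where w: "w \<in> infwords \<Sigma>" "pfx w (length u) = u" using extends_to_infword[OF u] .
      define m where "m = Min (diameter ` E ` children \<Sigma> u)"
      have m: "m \<le> diameter (E v)" "0 < m" unfolding m_def by (rule Min_children_le[OF u vu])+
      have ratio: "\<bar>ln (diameter (E u)) / ln m - 1\<bar> < \<epsilon>" using N[OF Nu w(1)] w(2) by (simp add: m_def)
      have lnk: "ln ((1/2) ^ k :: real) = - (real k * ln 2)" by (simp add: ln_realpow ln_div)
      have ln1: "ln m \<le> ln (diameter (E v))" using m by simp
      have ln2: "ln (diameter (E v)) \<le> - (real k * ln 2)"
        using dv m unfolding lnk[symmetric] by (subst ln_le_cancel_iff) auto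
      have ln3: "- (real k * ln 2) < ln (diameter (E u))"
        using du unfolding lnk[symmetric] by (subst ln_less_cancel_iff) (auto intro: less_trans[OF _ du])
      have "0 < real k * ln 2" using elim by simp
      then have "ln m < 0" using ln1 ln2 by linarith
      moreover have "1 - \<epsilon> < ln (diameter (E u)) / ln m" using ratio by linarith
      ultimately have "ln (diameter (E u)) < (1 - \<epsilon>) * ln m" by (simp add: neg_less_divide_eq)
      moreover have "(1 - \<epsilon>) * ln m \<le> (1 - \<epsilon>) * ln (diameter (E v))"
        using ln1 \<epsilon>(3) by (intro mult_left_mono) auto
      ultimately have "- (real k * ln 2) < (1 - \<epsilon>) * ln (diameter (E v))"
        using ln3 by linarith
      then have "(1 + \<eta>) * - (real k * ln 2) < (1 + \<eta>) * ((1 - \<epsilon>) * ln (diameter (E v)))"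
        using \<eta> by (intro mult_strict_left_mono) auto
      also have "\<dots> = ((1 - \<epsilon>) * (1 + \<eta>)) * ln (diameter (E v))" by (simp only: ac_simps)
      also have "\<dots> = ln (diameter (E v))" using \<epsilon>(2) by simp
      finally have "- (1 + \<eta>) * real k * ln 2 \<le> ln (diameter (E v))" by (simp add: algebra_simps)
      then show "2 powr (- (1 + \<eta>) * real k) \<le> diameter (E v)"
        using diam_pos[OF vS(1)] by (simp add: powr_def ln_ge_iff)
    qed
  qed
qed

section \<open>Cylinders with too heavy balls around their points\<close>

text \<open>One bad point condemns the entire cylinder. The exceptional set is thus a union of
  cylinders, hence measurable, and its mass can be summed cylinder by cylinder.\<close>

definition heavy :: "real \<Rightarrow> nat \<Rightarrow> 'i list set" where
  "heavy \<delta> k = {v \<in> stopping k. \<exists>x\<in>E v. 2 powr (\<delta> * real k) * measure M (E v) < measure M (cball x ((1/2) ^ k))}"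

text \<open>The inner balls from (M4) lie in disjoint cylinders, so their centres are separated by
  C0 times the diameters. If y is within (1/2)^k of x v, the centre of the inner ball of E v is
  within 2 * (1/2)^k of y, and packing bounds the number of such v. The 4 in the size hypothesis is
  twice the 2 of this radius.\<close>

lemma stopping_overlap:
  assumes doubling: "\<And>(x::'a) r. 0 < r \<Longrightarrow> \<exists>C. finite C \<and> card C \<le> N \<and> cball x r \<subseteq> (\<Union>c\<in>C. cball c (r/2))"
    and C0: "0 < C0" "\<And>v. v \<in> \<Sigma> \<Longrightarrow> \<exists>x\<in>E v. cball x (C0 * diameter (E v)) \<subseteq> E v"
    and F: "F \<subseteq> stopping k" and x: "\<And>v. v \<in> F \<Longrightarrow> x v \<in> E v"
    and small: "\<And>v. v \<in> F \<Longrightarrow> 4 * (1/2) ^ k / 2 ^ m \<le> C0 * diameter (E v)"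
  shows "card {v \<in> F. y \<in> cball (x v) ((1/2) ^ k)} \<le> N ^ m"
proof -
  have FS: "v \<in> \<Sigma>" if "v \<in> F" for v using F that by (auto simp: stopping_def)
  have "\<forall>v\<in>F. \<exists>z. z \<in> E v \<and> cball z (C0 * diameter (E v)) \<subseteq> E v"
  proof
    fix v assume "v \<in> F"
    from C0(2)[OF FS[OF this]] show "\<exists>z. z \<in> E v \<and> cball z (C0 * diameter (E v)) \<subseteq> E v"
      by (simp only: Bex_def)
  qed
  from bchoice[OF this] obtain z where "\<forall>v\<in>F. z v \<in> E v \<and> cball (z v) (C0 * diameter (E v)) \<subseteq> E v" ..
  then have z: "z v \<in> E v" "cball (z v) (C0 * diameter (E v)) \<subseteq> E v" if "v \<in> F" for v
    using that by simp_all
  show ?thesis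
  proof (rule doubling_packing[OF doubling, where z = z and r = "2 * (1/2) ^ k" and y = y])
    fix v assume "v \<in> {v \<in> F. y \<in> cball (x v) ((1/2) ^ k)}"
    then have v: "v \<in> F" "dist (x v) y \<le> (1/2) ^ k" by auto
    have "dist (x v) (z v) \<le> diameter (E v)"
      using v(1) by (intro diameter_bounded_bound compact_imp_bounded compact_E FS x z)
    also have "\<dots> \<le> (1/2) ^ k" using F v by (auto simp: stopping_def)
    finally show "z v \<in> cball y (2 * (1/2) ^ k)"
      using v(2) dist_triangle[of y "z v" "x v"] by (simp add: dist_commute)
  next
    fix u v assume "u \<in> {v \<in> F. y \<in> cball (x v) ((1/2) ^ k)}" "v \<in> {v \<in> F. y \<in> cball (x v) ((1/2) ^ k)}" "u \<noteq> v"
    then have uv: "u \<in> F" "v \<in> F" "u \<noteq> v" by auto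
    then have "E u \<inter> E v = {}" using F by (intro stopping_disjoint[of u k v]) auto
    then have "z v \<notin> cball (z u) (C0 * diameter (E u))" using z(1)[OF uv(2)] z(2)[OF uv(1)] by blast
    then show "2 * (2 * (1/2) ^ k) / 2 ^ m < dist (z u) (z v)" using small[OF uv(1)] by simp
  qed auto
qed

text \<open>Bounded overlap: each heavy cylinder is outweighed by a ball of 2^(\<delta> k) times its
  mass, and the masses of these balls sum to the integral of a counting function bounded by B.
  Finite families come first; truncating the word length gives finite families that exhaust all
  heavy words.\<close>

lemma measure_heavy_le:
  assumes overlap: "\<And>F x y. finite F \<Longrightarrow> F \<subseteq> stopping k \<Longrightarrow> (\<And>v. v \<in> F \<Longrightarrow> x v \<in> E v) \<Longrightarrow>
      real (card {v \<in> F. y \<in> cball (x v) ((1/2) ^ k)}) \<le> B"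
  shows "measure M (\<Union>v\<in>heavy \<delta> k. E v) \<le> 2 powr (- \<delta> * real k) * (B * measure M UNIV)"
proof -
  let ?r = "(1/2) ^ k :: real"
  have heavyS: "heavy \<delta> k \<subseteq> \<Sigma>" by (auto simp: heavy_def stopping_def)
  have fin: "measure M (\<Union>v\<in>F. E v) \<le> 2 powr (- \<delta> * real k) * (B * measure M UNIV)"
    if F: "finite F" "F \<subseteq> heavy \<delta> k" for F
  proof -
    have "\<forall>v\<in>F. \<exists>x. x \<in> E v \<and> 2 powr (\<delta> * real k) * measure M (E v) < measure M (cball x ?r)"
    proof
      fix v assume "v \<in> F"
      then have "v \<in> heavy \<delta> k" using F(2) by (rule rev_subsetD)
      then show "\<exists>x. x \<in> E v \<and> 2 powr (\<delta> * real k) * measure M (E v) < measure M (cball x ?r)"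
        by (simp only: heavy_def mem_Collect_eq Bex_def)
    qed
    from bchoice[OF this] obtain x
      where "\<forall>v\<in>F. x v \<in> E v \<and> 2 powr (\<delta> * real k) * measure M (E v) < measure M (cball (x v) ?r)" ..
    then have x: "x v \<in> E v" "2 powr (\<delta> * real k) * measure M (E v) < measure M (cball (x v) ?r)"
      if "v \<in> F" for v
      using that by simp_all
    have int: "integrable M (indicator (cball (x v) ?r) :: _ \<Rightarrow> real)" for v
      by (intro integrable_real_indicator) (auto simp: less_top[symmetric])
    have "measure M (\<Union>v\<in>F. E v) \<le> (\<Sum>v\<in>F. measure M (E v))"
      using F heavyS by (intro finite_measure_subadditive_finite) auto
    also have "\<dots> \<le> (\<Sum>v\<in>F. 2 powr (- \<delta> * real k) * measure M (cball (x v) ?r))"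
    proof (rule sum_mono)
      fix v assume "v \<in> F"
      from x(2)[OF this] have "2 powr (- \<delta> * real k) * (2 powr (\<delta> * real k) * measure M (E v))
          \<le> 2 powr (- \<delta> * real k) * measure M (cball (x v) ?r)"
        by (intro mult_left_mono) auto
      moreover have "2 powr (- \<delta> * real k) * 2 powr (\<delta> * real k) = 1" by (simp flip: powr_add)
      ultimately show "measure M (E v) \<le> 2 powr (- \<delta> * real k) * measure M (cball (x v) ?r)"
        by (simp only: mult.assoc[symmetric] mult_1)
    qed
    also have "\<dots> = 2 powr (- \<delta> * real k) * (\<Sum>v\<in>F. measure M (cball (x v) ?r))"
      by (simp add: sum_distrib_left)
    also have "(\<Sum>v\<in>F. measure M (cball (x v) ?r)) = (\<integral>y. (\<Sum>v\<in>F. indicator (cball (x v) ?r) y) \<partial>M)"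
      using int by (subst Bochner_Integration.integral_sum) auto
    also have "\<dots> \<le> (\<integral>y. B \<partial>M)"
    proof (rule integral_mono)
      show "integrable M (\<lambda>y. \<Sum>v\<in>F. indicator (cball (x v) ?r) y :: real)"
        using int by (intro Bochner_Integration.integrable_sum) auto
      fix y
      have "(\<Sum>v\<in>F. indicator (cball (x v) ?r) y :: real) = (\<Sum>v\<in>F. if y \<in> cball (x v) ?r then 1 else 0)"
        by (intro sum.cong) (auto simp: indicator_def)
      also have "\<dots> = real (card {v \<in> F. y \<in> cball (x v) ?r})"
        using F(1) by (simp flip: sum.inter_filter)
      also have "\<dots> \<le> B" using F by (intro overlap x) (auto simp: heavy_def)
      finally show "(\<Sum>v\<in>F. indicator (cball (x v) ?r) y) \<le> B" .
    qed auto
    also have "\<dots> = B * measure M UNIV" by simp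
    finally show ?thesis by simp
  qed
  define A where "A = (\<lambda>n. \<Union>v\<in>{v \<in> heavy \<delta> k. length v \<le> n}. E v)"
  have "(\<lambda>n. measure M (A n)) \<longlonglongrightarrow> measure M (\<Union>n. A n)"
  proof (rule finite_Lim_measure_incseq)
    show "range A \<subseteq> sets M" using heavyS by (auto simp: A_def intro!: sets_UN_E)
    show "incseq A" by (fastforce simp: A_def incseq_def)
  qed
  moreover have "(\<Union>n. A n) = (\<Union>v\<in>heavy \<delta> k. E v)" by (auto simp: A_def)
  moreover have "measure M (A n) \<le> 2 powr (- \<delta> * real k) * (B * measure M UNIV)" for n
    unfolding A_def using heavyS by (intro fin) (auto intro: finite_subset[OF _ finite_length_le[of n]])
  ultimately show ?thesis by (auto intro: LIMSEQ_le_const2)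
qed

lemma inner_ball: "\<exists>C0>0. \<forall>v\<in>\<Sigma>. \<exists>x\<in>E v. cball x (C0 * diameter (E v)) \<subseteq> E v"
  using moran by (simp add: moran_def)

lemma AE_not_heavy:
  assumes doubling: "doubling (UNIV :: 'a set)" and \<delta>: "0 < \<delta>"
  shows "AE x in M. eventually (\<lambda>k. x \<notin> (\<Union>v\<in>heavy \<delta> k. E v)) sequentially"
proof -
  have "\<exists>N::nat. \<forall>x::'a. \<forall>r>0. \<exists>C. finite C \<and> card C \<le> N \<and> cball x r \<subseteq> (\<Union>c\<in>C. cball c (r/2))"
    using doubling by (simp add: doubling_def)
  then obtain N :: nat where "\<forall>x::'a. \<forall>r>0. \<exists>C. finite C \<and> card C \<le> N \<and> cball x r \<subseteq> (\<Union>c\<in>C. cball c (r/2))" ..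
  then have N: "\<exists>C. finite C \<and> card C \<le> N \<and> cball x r \<subseteq> (\<Union>c\<in>C. cball c (r/2))" if "0 < r" for x :: 'a and r
    using that by simp
  obtain C0 where C0: "0 < C0" "\<And>v. v \<in> \<Sigma> \<Longrightarrow> \<exists>x\<in>E v. cball x (C0 * diameter (E v)) \<subseteq> E v"
    using inner_ball by blast
  obtain K where K: "4 / C0 < 2 ^ K" using real_arch_pow[of 2 "4 / C0"] by auto
  \<comment> \<open>As N \<le> 2^N, the overlap N^(m k) is at most 2^(N m k) with m k close to
    \<eta> k. With N \<eta> \<le> \<delta> / 2 it uses up at most half of the gain 2^(-\<delta> k),
    and the remainder is geometric. The added 1 keeps the denominator positive.\<close>
  define \<eta> where "\<eta> = \<delta> / (2 * (real N + 1))"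
  have \<eta>: "0 < \<eta>" "real N * \<eta> \<le> \<delta> / 2" using \<delta> by (auto simp: \<eta>_def field_simps)
  \<comment> \<open>The number of halvings leading from the radius 2 * (1/2)^k below the size of the
    inner balls: about \<eta> k for the diameters 2^(-(1 + \<eta>) k), and \<open>K\<close> for the
    constant 4 / C0.\<close>
  define m where "m = (\<lambda>k. nat \<lceil>real k * \<eta>\<rceil> + K)"
  have "eventually (\<lambda>k. measure M (\<Union>v\<in>heavy \<delta> k. E v) \<le>
      (2 powr (- \<delta> / 2)) ^ k * (2 powr (real N * (1 + real K)) * measure M UNIV)) sequentially"
    using stopping_diameter[OF \<eta>(1)]
  proof eventually_elim
    case (elim k)
    have m: "2 powr (real k * \<eta>) * 2 ^ K \<le> 2 ^ m k"
    proof -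
      have "2 powr (real k * \<eta>) \<le> 2 powr (real (nat \<lceil>real k * \<eta>\<rceil>))"
        by (intro powr_mono real_nat_ceiling_ge) auto
      then show ?thesis by (simp add: m_def power_add powr_realpow)
    qed
    have small: "4 * (1/2) ^ k / 2 ^ m k \<le> C0 * diameter (E v)" if "v \<in> stopping k" for v
    proof -
      have "4 \<le> C0 * 2 ^ K" using K C0(1) by (simp add: field_simps)
      then have "4 * (1/2) ^ k / 2 ^ m k \<le> C0 * 2 ^ K * (1/2) ^ k / (2 powr (real k * \<eta>) * 2 ^ K)"
        using C0(1) by (intro frac_le mult_right_mono m) auto
      also have "\<dots> = C0 * ((1/2) ^ k / 2 powr (real k * \<eta>))" by simp
      also have "\<dots> = C0 * 2 powr (- (1 + \<eta>) * real k)"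
      proof -
        have "(1/2) ^ k = 2 powr (- real k)"
          by (simp add: powr_minus powr_realpow power_one_over inverse_eq_divide)
        moreover have "- real k - real k * \<eta> = - (1 + \<eta>) * real k" by (simp add: algebra_simps)
        ultimately show ?thesis by (simp only: powr_diff[symmetric])
      qed
      also have "\<dots> \<le> C0 * diameter (E v)" using elim that C0(1) by (intro mult_left_mono) auto
      finally show ?thesis .
    qed
    have "measure M (\<Union>v\<in>heavy \<delta> k. E v) \<le> 2 powr (- \<delta> * real k) * (real N ^ m k * measure M UNIV)"
    proof (rule measure_heavy_le)
      fix F x y assume F: "finite F" "F \<subseteq> stopping k" "\<And>v. v \<in> F \<Longrightarrow> x v \<in> E v"
      have "card {v \<in> F. y \<in> cball (x v) ((1/2) ^ k)} \<le> N ^ m k"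
        using F small by (intro stopping_overlap[OF N C0]) auto
      then show "real (card {v \<in> F. y \<in> cball (x v) ((1/2) ^ k)}) \<le> real N ^ m k"
        by (simp only: of_nat_le_iff flip: of_nat_power)
    qed
    also have "real N ^ m k \<le> 2 powr (real N * (1 + real K)) * 2 powr (\<delta> / 2 * real k)"
    proof -
      have "real N ^ m k \<le> (2 ^ N) ^ m k"
        by (intro power_mono) (auto simp: less_imp_le[OF of_nat_less_two_power])
      also have "\<dots> = 2 powr (real N * real (m k))"
        by (simp only: power_mult[symmetric] of_nat_mult[symmetric]) (rule powr_realpow[symmetric], simp)
      also have "\<dots> \<le> 2 powr (real N * (1 + real K) + \<delta> / 2 * real k)"
      proof (intro powr_mono)
        have "real (m k) \<le> real k * \<eta> + 1 + real K"
    proof -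
          have "0 \<le> real k * \<eta>" using \<eta>(1) by simp
          then have "real (nat \<lceil>real k * \<eta>\<rceil>) = of_int \<lceil>real k * \<eta>\<rceil>" by simp
          then have "real (nat \<lceil>real k * \<eta>\<rceil>) \<le> real k * \<eta> + 1" by linarith
          then show ?thesis by (simp add: m_def)
        qed
        then have "real N * real (m k) \<le> real N * (1 + real K) + (real N * \<eta>) * real k"
          using mult_left_mono[of "real (m k)" "real k * \<eta> + 1 + real K" "real N"]
          by (simp add: algebra_simps)
        also have "\<dots> \<le> real N * (1 + real K) + \<delta> / 2 * real k"
          using \<eta>(2) by (intro add_left_mono mult_right_mono) auto
        finally show "real N * real (m k) \<le> real N * (1 + real K) + \<delta> / 2 * real k" .
      qed auto
      finally show ?thesis by (simp add: powr_add)
    qed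
    then have "2 powr (- \<delta> * real k) * (real N ^ m k * measure M UNIV) \<le>
        2 powr (- \<delta> * real k) * ((2 powr (real N * (1 + real K)) * 2 powr (\<delta> / 2 * real k)) * measure M UNIV)"
      by (intro mult_left_mono mult_right_mono) auto
    also have "\<dots> = (2 powr (- \<delta> * real k) * 2 powr (\<delta> / 2 * real k)) * (2 powr (real N * (1 + real K)) * measure M UNIV)"
      by (simp only: ac_simps)
    also have "2 powr (- \<delta> * real k) * 2 powr (\<delta> / 2 * real k) = (2 powr (- \<delta> / 2)) ^ k"
    proof -
      have "- \<delta> * real k + \<delta> / 2 * real k = - \<delta> / 2 * real k" by (simp add: field_simps)
      then have "2 powr (- \<delta> * real k) * 2 powr (\<delta> / 2 * real k) = 2 powr (- \<delta> / 2 * real k)"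
        by (simp only: powr_add[symmetric])
      also have "\<dots> = (2 powr (- \<delta> / 2)) ^ k" by (simp only: powr_powr[symmetric]) (simp add: powr_realpow)
      finally show ?thesis .
    qed
    finally show ?case .
  qed
  then have "eventually (\<lambda>k. norm (measure M (\<Union>v\<in>heavy \<delta> k. E v)) \<le>
      (2 powr (- \<delta> / 2)) ^ k * (2 powr (real N * (1 + real K)) * measure M UNIV)) sequentially"
    by simp
  moreover have "2 powr (- \<delta> / 2) < 2 powr 0" using \<delta> by (intro powr_less_mono) auto
  then have "summable (\<lambda>k. (2 powr (- \<delta> / 2)) ^ k * (2 powr (real N * (1 + real K)) * measure M UNIV))"
    by (intro summable_mult2 summable_geometric) auto
  ultimately have "summable (\<lambda>k. measure M (\<Union>v\<in>heavy \<delta> k. E v))"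
    by (rule summable_comparison_test_ev)
  then have "AE x in M. eventually (\<lambda>k. x \<in> space M - (\<Union>v\<in>heavy \<delta> k. E v)) sequentially"
    by (intro borel_cantelli_AE1 sets_UN_E) (auto simp: heavy_def stopping_def less_top[symmetric])
  then show ?thesis by eventually_elim (auto elim: eventually_mono)
qed

section \<open>Diameters and masses along one branch\<close>

lemma coded_log_diameter_mono:
  assumes w: "w \<in> infwords \<Sigma>"
  shows "incseq (\<lambda>n. - ln (diameter (E (pfx w n))))"
proof (rule incseq_SucI)
  fix n
  have "diameter (E (pfx w (Suc n))) \<le> diameter (E (pfx w n))"
    by (intro diameter_prefix infwordsD[OF w]) (simp add: pfx_Suc)
  then show "- ln (diameter (E (pfx w n))) \<le> - ln (diameter (E (pfx w (Suc n))))"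
    using diam_pos[OF infwordsD[OF w, of "Suc n"]] by simp
qed

lemma coded_log_diameter_at_top:
  assumes w: "w \<in> infwords \<Sigma>"
  shows "filterlim (\<lambda>n. - ln (diameter (E (pfx w n)))) at_top sequentially"
proof -
  have "(\<lambda>n. diameter (E (pfx w n))) \<longlonglongrightarrow> 0" using moran w by (simp add: moran_def)
  then have "filterlim (\<lambda>n. diameter (E (pfx w n))) (at_right 0) sequentially"
    using diam_pos[OF infwordsD[OF w]] by (auto simp: filterlim_at less_imp_neq[symmetric])
  from filterlim_compose[OF ln_at_0 this] show ?thesis by (simp add: filterlim_uminus_at_top)
qed

text \<open>The next cylinder on the branch is at least as large as the smallest child, so the ratio
  lies between the (M5) quotient and 1 once b is positive.\<close>

lemma coded_diameter_ratio:
  assumes w: "w \<in> infwords \<Sigma>"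
  defines "b \<equiv> \<lambda>n. - ln (diameter (E (pfx w n)))"
  shows "(\<lambda>n. b n / b (Suc n)) \<longlonglongrightarrow> 1"
proof -
  define m where "m = (\<lambda>n. Min (diameter ` E ` children \<Sigma> (pfx w n)))"
  have m: "m n \<le> diameter (E (pfx w (Suc n)))" "0 < m n" for n
    unfolding m_def by (rule Min_children_le[OF infwordsD[OF w] pfx_Suc_children[OF w]])+
  have ratio: "(\<lambda>n. ln (diameter (E (pfx w n))) / ln (m n)) \<longlonglongrightarrow> 1"
  proof (rule LIMSEQ_I)
    fix \<epsilon> :: real assume "0 < \<epsilon>"
    from uniform_diameter_ratio[OF this] w show "\<exists>no. \<forall>n\<ge>no. norm (ln (diameter (E (pfx w n))) / ln (m n) - 1) < \<epsilon>"
      unfolding m_def real_norm_def by blast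
  qed
  show ?thesis
  proof (rule tendsto_sandwich[OF _ _ ratio tendsto_const])
    have b1: "b n \<le> b (Suc n)" for n
      unfolding b_def using incseq_SucD[OF coded_log_diameter_mono[OF w]] .
    have bm: "b (Suc n) \<le> - ln (m n)" for n using m[of n] by (simp add: b_def)
    have "filterlim b at_top sequentially"
      unfolding b_def by (rule coded_log_diameter_at_top[OF w])
    then have ev: "eventually (\<lambda>n. 0 < b n) sequentially" unfolding filterlim_at_top_dense by blast
    show "eventually (\<lambda>n. ln (diameter (E (pfx w n))) / ln (m n) \<le> b n / b (Suc n)) sequentially"
      using ev
    proof eventually_elim
      case (elim n)
      then have "b n / - ln (m n) \<le> b n / b (Suc n)"
        using b1[of n] bm[of n] by (intro divide_left_mono mult_pos_pos) auto
      then show ?case by (simp add: b_def)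
    qed
    show "eventually (\<lambda>n. b n / b (Suc n) \<le> 1) sequentially"
      using ev
    proof eventually_elim
      case (elim n)
      then show ?case using b1[of n] by simp
    qed
  qed
qed

text \<open>One inequality holds at every coded point: a cylinder containing x of diameter at most r
  lies in the ball of radius r about x. The converse holds at dyadic radii up to 2^(\<delta> k),
  since the stopped word of the branch is eventually not heavy. Running \<delta> through 1 / (i + 1)
  keeps the exceptional set null.\<close>

lemma local_dim_cylinders:
  assumes doubling: "doubling (UNIV :: 'a set)"
  shows "AE x in M. \<forall>w\<in>infwords \<Sigma>. x \<in> coding_set E w \<longrightarrow>
    upper_local_dim M x = limsup (\<lambda>n. ereal (ln (measure M (E (pfx w n))) / ln (diameter (E (pfx w n))))) \<and>
    lower_local_dim M x = liminf (\<lambda>n. ereal (ln (measure M (E (pfx w n))) / ln (diameter (E (pfx w n)))))"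
proof -
  have "AE x in M. \<forall>i. eventually (\<lambda>k. x \<notin> (\<Union>v\<in>heavy (inverse (real (Suc i))) k. E v)) sequentially"
    using AE_not_heavy[OF doubling] by (subst AE_all_countable) simp
  with AE_pos show ?thesis
  proof eventually_elim
    case (elim x)
    show ?case
    proof (intro ballI impI)
      fix w assume w: "w \<in> infwords \<Sigma>" and xw: "x \<in> coding_set E w"
      define a where "a = (\<lambda>n. - ln (measure M (E (pfx w n))))"
      define b where "b = (\<lambda>n. - ln (diameter (E (pfx w n))))"
      define G where "G = (\<lambda>t. - ln (measure M (cball x (exp (- t)))))"
      note wS = infwordsD[OF w] and x = coding_setD[OF xw]
      have mpos: "0 < measure M (E (pfx w n))" for n using elim(1) wS x by blast
      have blim: "filterlim b at_top sequentially" unfolding b_def by (rule coded_log_diameter_at_top[OF w])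
      have in_ball: "E (pfx w n) \<subseteq> cball x (exp (- t))" if "t \<le> b n" for n t
      proof
        fix y assume "y \<in> E (pfx w n)"
        then have "dist x y \<le> diameter (E (pfx w n))"
          using x wS by (intro diameter_bounded_bound compact_imp_bounded compact_E)
        also have "\<dots> = exp (- b n)" using diam_pos[OF wS] by (simp add: b_def)
        also have "\<dots> \<le> exp (- t)" using that by simp
        finally show "y \<in> cball x (exp (- t))" by simp
      qed
      have ball_ge: "measure M (E (pfx w n)) \<le> measure M (cball x (exp (- t)))" if "t \<le> b n" for n t
        by (rule finite_measure_mono[OF in_ball[OF that] sets_cball])
      have ball_pos: "0 < measure M (cball x (exp (- t)))" for t
      proof -
        obtain n where "t \<le> b n" using blim unfolding filterlim_at_top eventually_sequentially by blast
        then show ?thesis using ball_ge[of t n] mpos[of n] by linarith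
      qed
      have upper: "G t \<le> a n" if "t \<le> b n" for n t
        using ball_ge[OF that] mpos[of n] by (simp add: G_def a_def)
      have lower: "(\<lambda>k. (a (LEAST n. real k * ln 2 \<le> b n) - G (real k * ln 2)) / real k) \<longlonglongrightarrow> 0"
      proof (rule LIMSEQ_I)
        fix \<epsilon> :: real assume \<epsilon>: "0 < \<epsilon>"
        obtain i where i: "inverse (real (Suc i)) < \<epsilon>" using reals_Archimedean[OF \<epsilon>] by blast
        \<comment> \<open>Requiring k ln 2 > b 0 makes the first generation at this scale nonzero.
          The word then has a parent that has not yet stopped, and so belongs to
          \<open>stopping k\<close>.\<close>
        have "eventually (\<lambda>k. k > 0 \<and> real k * ln 2 > b 0 \<and> x \<notin> (\<Union>v\<in>heavy (inverse (real (Suc i))) k. E v)) sequentially"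
        proof (intro eventually_conj)
          have "filterlim (\<lambda>k. real k * ln 2) at_top sequentially" by real_asymp
          then show "eventually (\<lambda>k. b 0 < real k * ln 2) sequentially" by (simp add: filterlim_at_top_dense)
        qed (use elim(2) eventually_gt_at_top in auto)
        then have "eventually (\<lambda>k. norm ((a (LEAST n. real k * ln 2 \<le> b n) - G (real k * ln 2)) / real k - 0) < \<epsilon>) sequentially"
        proof eventually_elim
          case (elim k)
          define t where "t = real k * ln 2"
          define n where "n = (LEAST n. t \<le> b n)"
          define v where "v = pfx w n"
          have exp_t: "exp (- t) = (1/2) ^ k"
          proof -
            have "exp (- t) = exp (- ln 2) ^ k" by (simp add: t_def flip: exp_of_nat_mult)
            then show ?thesis by (simp add: exp_minus inverse_eq_divide)
          qed
          have "\<exists>n. t \<le> b n" using blim unfolding filterlim_at_top eventually_sequentially by blast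
          then have tn: "t \<le> b n" unfolding n_def by (rule LeastI_ex)
          have "n \<noteq> 0"
          proof
            assume "n = 0"
            with tn have "t \<le> b 0" by simp
            then show False using elim by (simp add: t_def)
          qed
          then have nb: "b (n - 1) < t"
            using not_less_Least[of "n - 1" "\<lambda>n. t \<le> b n"] by (simp add: n_def)
          have "v \<in> stopping k"
          proof -
            have "diameter (E v) = exp (- b n)" using diam_pos[OF wS] by (simp add: b_def v_def)
            also have "\<dots> \<le> (1/2) ^ k" using tn by (simp flip: exp_t)
            finally have 1: "diameter (E v) \<le> (1/2) ^ k" .
            have bl: "butlast v = pfx w (n - 1)" using \<open>n \<noteq> 0\<close> butlast_pfx_Suc[of w "n - 1"] by (simp add: v_def)
            have "(1/2) ^ k < exp (- b (n - 1))" using nb by (simp flip: exp_t)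
            also have "\<dots> = diameter (E (butlast v))" using diam_pos[OF wS] by (simp add: b_def bl)
            finally have 2: "(1/2) ^ k < diameter (E (butlast v))" .
            have "v \<noteq> []" using \<open>n \<noteq> 0\<close> by (cases n) (auto simp: v_def pfx_Suc)
            then show ?thesis using 1 2 wS by (simp add: stopping_def v_def)
          qed
          moreover have "v \<notin> heavy (inverse (real (Suc i))) k" using elim x[of n] by (auto simp: v_def)
          ultimately have "\<not> 2 powr (inverse (real (Suc i)) * real k) * measure M (E v) < measure M (cball x ((1/2) ^ k))"
            using x[of n] unfolding heavy_def v_def by blast
          then have "measure M (cball x (exp (- t))) \<le> 2 powr (inverse (real (Suc i)) * real k) * measure M (E v)"
            by (simp add: exp_t)
          then have "ln (measure M (cball x (exp (- t)))) \<le> ln (2 powr (inverse (real (Suc i)) * real k) * measure M (E v))"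
            using ball_pos[of t] by (intro ln_mono) auto
          also have "\<dots> = inverse (real (Suc i)) * real k * ln 2 + ln (measure M (E v))"
            using mpos[of n] by (simp add: ln_mult ln_powr v_def)
          finally have "a n - G t \<le> inverse (real (Suc i)) * real k * ln 2" by (simp add: a_def G_def v_def)
          also have "\<dots> \<le> inverse (real (Suc i)) * real k * 1" using ln_2_less_1 by (intro mult_left_mono) auto
          finally have "(a n - G t) / real k \<le> inverse (real (Suc i))" using elim by (simp add: divide_le_eq)
          moreover have "0 \<le> (a n - G t) / real k" using upper[OF tn] by simp
          ultimately show ?case using i by (simp add: n_def t_def)
        qed
        then show "\<exists>no. \<forall>k\<ge>no. norm ((a (LEAST n. real k * ln 2 \<le> b n) - G (real k * ln 2)) / real k - 0) < \<epsilon>"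
          by (simp add: eventually_sequentially)
      qed
      have "mono G"
      proof
        fix s t :: real assume "s \<le> t"
        then have "cball x (exp (- t)) \<subseteq> cball x (exp (- s))" by (simp add: subset_cball)
        then have "measure M (cball x (exp (- t))) \<le> measure M (cball x (exp (- s)))"
          by (rule finite_measure_mono) (rule sets_cball)
        then show "G s \<le> G t" using ball_pos[of t] by (simp add: G_def)
      qed
      moreover have "incseq a"
      proof (rule incseq_SucI)
        fix n
        have "measure M (E (pfx w (Suc n))) \<le> measure M (E (pfx w n))"
          by (intro finite_measure_mono child_subset pfx_Suc_children w sets_E wS)
        then show "a n \<le> a (Suc n)" using mpos[of "Suc n"] by (simp add: a_def)
      qed
      moreover have "(\<lambda>n. b n / b (Suc n)) \<longlonglongrightarrow> 1" unfolding b_def by (rule coded_diameter_ratio[OF w])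
      moreover have "incseq b" unfolding b_def by (rule coded_log_diameter_mono[OF w])
      ultimately have eq: "Limsup at_top (\<lambda>t. ereal (G t / t)) = limsup (\<lambda>n. ereal (a n / b n))"
        "Liminf at_top (\<lambda>t. ereal (G t / t)) = liminf (\<lambda>n. ereal (a n / b n))"
        using Limsup_Liminf_scale_eq[OF _ _ _ blim _ upper lower] by simp_all
      \<comment> \<open>Balls about x have positive mass, each containing a cylinder of the branch,
        so the infinite values of \<open>logratio\<close> do not occur here.\<close>
      have ev: "eventually (\<lambda>t. logratio M x (exp (- t)) = ereal (G t / t)) at_top"
        using eventually_gt_at_top[of 0]
      proof eventually_elim
        case (elim t)
        then show ?case using ball_pos[of t] by (simp add: logratio_def G_def)
      qed
      have inj: "inj (\<lambda>t::real. exp (- t))" by (auto simp: inj_def)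
      have "upper_local_dim M x = limsup (\<lambda>n. ereal (a n / b n))"
        unfolding upper_local_dim_def at_right_0_eq_exp_uminus Limsup_filtermap_eq[OF inj] Limsup_eq[OF ev] by (rule eq)
      moreover have "lower_local_dim M x = liminf (\<lambda>n. ereal (a n / b n))"
        unfolding lower_local_dim_def at_right_0_eq_exp_uminus Liminf_filtermap_eq[OF inj] Liminf_eq[OF ev] by (rule eq)
      ultimately show "upper_local_dim M x = limsup (\<lambda>n. ereal (ln (measure M (E (pfx w n))) / ln (diameter (E (pfx w n))))) \<and>
          lower_local_dim M x = liminf (\<lambda>n. ereal (ln (measure M (E (pfx w n))) / ln (diameter (E (pfx w n)))))"
        by (simp add: a_def b_def)
    qed
  qed
qed

section \<open>Entropy averages\<close>

lemma level_nonempty: "level \<Sigma> n \<noteq> {}"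
proof -
  obtain w where "w \<in> infwords \<Sigma>" using extends_to_infword[OF Nil_in] .
  then have "pfx w n \<in> level \<Sigma> n" by (simp add: level_def infwordsD)
  then show ?thesis by blast
qed

lemma psq_nonneg: "0 \<le> psq (pw M E u) c"
  using pw_nonneg[of u] by (simp add: psq_def)

text \<open>The strong law is applied to ln \<open>pw\<close> and to ln \<open>cw\<close>. Along a
  branch these are the increments of the logarithms of mass and of diameter, and both second moments
  are dominated by the same \<open>psq\<close> sums.\<close>

lemma AE_entropy_averages:
  defines "s \<equiv> \<lambda>n. SUP v\<in>level \<Sigma> n. \<Sum>u\<in>children \<Sigma> v. psq (pw M E u) (cw E u)"
  assumes summable: "summable (\<lambda>n. (1 / (real n)\<^sup>2) * s n)"
  shows "AE x in M. \<forall>w\<in>infwords \<Sigma>. x \<in> coding_set E w \<longrightarrow>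
      (\<lambda>N. (ln (measure M (E (pfx w (Suc N)))) -
        (\<Sum>n=1..N. \<Sum>u\<in>children \<Sigma> (pfx w n). plogp (pw M E u))) / real (Suc N)) \<longlonglongrightarrow> 0 \<and>
      (\<lambda>N. (ln (diameter (E (pfx w (Suc N)))) -
        (\<Sum>n=1..N. \<Sum>u\<in>children \<Sigma> (pfx w n). pw M E u * ln (cw E u))) / real (Suc N)) \<longlonglongrightarrow> 0"
proof -
  \<comment> \<open>Levels are finite, so the real supremum is that of a bounded set and really is
    an upper bound.\<close>
  have le_s: "(\<Sum>u\<in>children \<Sigma> v. psq (pw M E u) (cw E u)) \<le> s (length v)" if "v \<in> \<Sigma>" for v
    unfolding s_def using that finite_level
    by (intro cSUP_upper bdd_above_finite finite_imageI) (auto simp: level_def)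
  have s_nonneg: "0 \<le> s n" for n
  proof -
    obtain v where "v \<in> level \<Sigma> n" using level_nonempty by blast
    then have "0 \<le> (\<Sum>u\<in>children \<Sigma> v. psq (pw M E u) (cw E u))" "v \<in> \<Sigma>" "length v = n"
      by (auto intro: sum_nonneg psq_nonneg simp: level_def)
    then show ?thesis using le_s[of v] by simp
  qed
  \<comment> \<open>The hypothesis divides by n^2 and has the default term 0 at n = 0, whereas the
    strong law divides by (n + 1)^2; the comparison therefore starts at n = 1.\<close>
  have s_sum: "summable (\<lambda>n. s n / (real (Suc n))\<^sup>2)"
  proof (rule summable_comparison_test'[OF summable, where N = 1])
    fix n :: nat assume "1 \<le> n"
    then have "s n / (real (Suc n))\<^sup>2 \<le> s n / (real n)\<^sup>2"
      using s_nonneg by (intro divide_left_mono power_mono mult_pos_pos) auto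
    then show "norm (s n / (real (Suc n))\<^sup>2) \<le> 1 / (real n)\<^sup>2 * s n" using s_nonneg[of n] by simp
  qed
  have psq: "psq p c = p * (ln p)\<^sup>2 + p * (ln c)\<^sup>2" for p c :: real
    by (simp add: psq_def distrib_left)
  have bound_p: "(\<Sum>u\<in>children \<Sigma> v. pw M E u * (ln (pw M E u))\<^sup>2) \<le> s (length v)" if "v \<in> \<Sigma>" for v
    using le_s[OF that] by (rule order_trans[rotated]) (auto intro!: sum_mono simp: psq pw_nonneg)
  have bound_c: "(\<Sum>u\<in>children \<Sigma> v. pw M E u * (ln (cw E u))\<^sup>2) \<le> s (length v)" if "v \<in> \<Sigma>" for v
    using le_s[OF that] by (rule order_trans[rotated]) (auto intro!: sum_mono simp: psq pw_nonneg)
  let ?P = "\<lambda>g x. \<forall>w\<in>infwords \<Sigma>. x \<in> coding_set E w \<longrightarrow>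
    (\<lambda>N. (\<Sum>n<N. g (pfx w (Suc n)) - (\<Sum>u\<in>children \<Sigma> (pfx w n). pw M E u * g u)) / real N) \<longlonglongrightarrow> 0"
  have "AE x in M. ?P (\<lambda>u. ln (pw M E u)) x"
    by (rule strong_law) (fact bound_p s_nonneg s_sum)+
  moreover have "AE x in M. ?P (\<lambda>u. ln (cw E u)) x"
    by (rule strong_law) (fact bound_c s_nonneg s_sum)+
  ultimately show ?thesis using AE_pos
  proof eventually_elim
    case (elim x)
    show ?case
    proof (intro ballI impI conjI)
      fix w assume w: "w \<in> infwords \<Sigma>" "x \<in> coding_set E w"
      have mpos: "0 < measure M (E (pfx w n))" for n
        using elim(3) infwordsD[OF w(1)] coding_setD[OF w(2)] by blast
      have dpos: "0 < diameter (E (pfx w n))" for n by (rule diam_pos[OF infwordsD[OF w(1)]])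
      have nz: "pfx w (Suc n) \<noteq> []" for n by (simp add: pfx_Suc)
      have p: "ln (pw M E (pfx w (Suc n))) = ln (measure M (E (pfx w (Suc n)))) - ln (measure M (E (pfx w n)))" for n
        using mpos[of n] mpos[of "Suc n"] by (simp add: pw_def nz ln_div)
      have c: "ln (cw E (pfx w (Suc n))) = ln (diameter (E (pfx w (Suc n)))) - ln (diameter (E (pfx w n)))" for n
        using dpos[of n] dpos[of "Suc n"] by (simp add: cw_def nz ln_div)
      have plogp: "plogp q = q * ln q" for q by (simp add: plogp_def)
      show "(\<lambda>N. (ln (measure M (E (pfx w (Suc N)))) -
        (\<Sum>n=1..N. \<Sum>u\<in>children \<Sigma> (pfx w n). plogp (pw M E u))) / real (Suc N)) \<longlonglongrightarrow> 0"
        using elim(1)[rule_format, OF w] unfolding plogp p by (rule average_difference)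
      show "(\<lambda>N. (ln (diameter (E (pfx w (Suc N)))) -
        (\<Sum>n=1..N. \<Sum>u\<in>children \<Sigma> (pfx w n). pw M E u * ln (cw E u))) / real (Suc N)) \<longlonglongrightarrow> 0"
        using elim(2)[rule_format, OF w] unfolding c by (rule average_difference)
    qed
  qed
qed

end

section \<open>Finiteness of the measure and conclusion\<close>

text \<open>The limit set lies in the compact, hence bounded, root cylinder. This is shown outside
  the locale because the locale presupposes it.\<close>

lemma moran_emeasure_finite:
  fixes M :: "'a::metric_space measure" and \<Sigma> :: "'i::countable list set"
  assumes moran: "moran \<Sigma> E" and borel: "sets M = sets borel"
    and loc_finite: "\<And>S. S \<in> sets M \<Longrightarrow> bounded S \<Longrightarrow> emeasure M S < \<infinity>"
    and on_E: "emeasure M (space M - limit_set \<Sigma> E) = 0"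
  shows "emeasure M (space M) \<noteq> \<infinity>"
proof -
  have sp: "space M = UNIV" using sets_eq_imp_space_eq[OF borel] by simp
  have "[] \<in> \<Sigma>" using moran by (simp add: moran_def codetree_def)
  then have cpt: "compact (E [])" using moran by (simp add: moran_def)
  have E: "E v \<in> sets M" if "v \<in> \<Sigma>" for v
    unfolding borel using that moran by (intro borel_closed compact_imp_closed) (simp add: moran_def)
  have "(\<Union>v\<in>level \<Sigma> n. E v) \<in> sets M" for n
    by (intro sets.countable_UN') (auto simp: level_def intro: E)
  then have L: "limit_set \<Sigma> E \<in> sets M" unfolding limit_set_def by (intro sets.countable_INT) auto
  have "limit_set \<Sigma> E \<subseteq> E []" by (fastforce simp: limit_set_def level_def)
  then have "space M \<subseteq> E [] \<union> (space M - limit_set \<Sigma> E)" by auto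
  then have "emeasure M (space M) \<le> emeasure M (E [] \<union> (space M - limit_set \<Sigma> E))"
    using L E[OF \<open>[] \<in> \<Sigma>\<close>] by (intro emeasure_mono sets.Un sets.compl_sets)
  also have "\<dots> \<le> emeasure M (E []) + emeasure M (space M - limit_set \<Sigma> E)"
    using L E[OF \<open>[] \<in> \<Sigma>\<close>] by (intro emeasure_subadditive sets.compl_sets)
  also have "\<dots> < \<infinity>"
    using loc_finite[OF E[OF \<open>[] \<in> \<Sigma>\<close>] compact_imp_bounded[OF cpt]] on_E by simp
  finally show ?thesis by simp
qed

theorem theorem4p3:
  fixes M :: "'a::complete_space measure"
    and \<Sigma> :: "'i::countable list set"
    and E :: "'i list \<Rightarrow> 'a set"
  assumes doubling: "doubling (UNIV :: 'a set)"
    and moran: "moran \<Sigma> E"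
    and borel: "sets M = sets borel"
    and nontrivial: "emeasure M (space M) \<noteq> 0"
    and loc_finite: "\<And>S. S \<in> sets M \<Longrightarrow> bounded S \<Longrightarrow> emeasure M S < \<infinity>"
    and on_E: "emeasure M (space M - limit_set \<Sigma> E) = 0"
    and decay: "\<And>w. w \<in> infwords \<Sigma> \<Longrightarrow>
        liminf (\<lambda>n. ereal (- ln (diameter (E (pfx w n))) / real n)) > 0"
    and summable: "summable (\<lambda>n. (1 / (real n)^2) *
        (SUP v\<in>level \<Sigma> n. \<Sum>j\<in>children \<Sigma> v. psq (pw M E j) (cw E j)))"
  shows "AE x in M. \<forall>w\<in>infwords \<Sigma>. x \<in> coding_set E w \<longrightarrow>
      upper_local_dim M x = limsup (\<lambda>N. ereal (entropy_ratio M \<Sigma> E w N)) \<and>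
      lower_local_dim M x = liminf (\<lambda>N. ereal (entropy_ratio M \<Sigma> E w N))"
proof -
  interpret finite_measure M
    by (rule finite_measureI) (rule moran_emeasure_finite[OF moran borel loc_finite on_E])
  interpret moran_measure M \<Sigma> E
    by unfold_locales (fact moran borel on_E)+
  from local_dim_cylinders[OF doubling] AE_entropy_averages[OF summable] show ?thesis
  proof eventually_elim
    case (elim x)
    show ?case
    proof (intro ballI impI)
      fix w assume w: "w \<in> infwords \<Sigma>" "x \<in> coding_set E w"
      \<comment> \<open>A real strictly between 0 and the lower limit is a linear growth rate of
        -log diam; it may depend on w.\<close>
      obtain \<kappa> where \<kappa>: "0 < ereal \<kappa>" "ereal \<kappa> < liminf (\<lambda>n. ereal (- ln (diameter (E (pfx w n))) / real n))"
        using ereal_dense2[OF decay[OF w(1)]] by blast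
      have "eventually (\<lambda>n. ereal \<kappa> < ereal (- ln (diameter (E (pfx w n))) / real n)) sequentially"
        by (rule le_Liminf_iff[THEN iffD1, rule_format, OF order_refl \<kappa>(2)])
      then have "eventually (\<lambda>n. \<kappa> < - ln (diameter (E (pfx w (Suc n)))) / real (Suc n)) sequentially"
        by (subst eventually_sequentially_Suc) simp
      then have grow: "eventually (\<lambda>n. \<kappa> * real (Suc n) \<le> \<bar>ln (diameter (E (pfx w (Suc n))))\<bar>) sequentially"
      proof eventually_elim
        case (elim n)
        then have "\<kappa> * real (Suc n) < - ln (diameter (E (pfx w (Suc n))))"
          by (subst (asm) pos_less_divide_eq) auto
        then show ?case by linarith
      qed
      have \<kappa>pos: "0 < \<kappa>" using \<kappa>(1) by simp
      note eq = limsup_liminf_ratio_eq[OF \<kappa>pos grow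
          elim(2)[rule_format, OF w, THEN conjunct1] elim(2)[rule_format, OF w, THEN conjunct2],
          folded entropy_ratio_def]
      \<comment> \<open>The entropy ratio up to N belongs to the cylinder of generation N + 1, so
        the cylinder quotients are shifted by one index.\<close>
      show "upper_local_dim M x = limsup (\<lambda>N. ereal (entropy_ratio M \<Sigma> E w N)) \<and>
          lower_local_dim M x = liminf (\<lambda>N. ereal (entropy_ratio M \<Sigma> E w N))"
        using elim(1)[rule_format, OF w]
          limsup_shift[of "\<lambda>n. ereal (ln (measure M (E (pfx w n))) / ln (diameter (E (pfx w n))))"]
          liminf_shift[of "\<lambda>n. ereal (ln (measure M (E (pfx w n))) / ln (diameter (E (pfx w n))))"]
        unfolding eq Suc_eq_plus1 by (simp only:)
    qed
  qed
qed

end
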